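(* Let $(M,g)$ be an extended recurrent Lorentzian manifold of dimension $n>3$ with associated covector $A$ and scalar functions $\beta,\psi$, and suppose $A^2:=A^mA_m<0$ everywhere. Put $u_k=A_k/\sqrt{-A^2}$, and let $T_{kl}$ be the tensor defined by Einstein's equations $R_{kl}-\frac12 R\,g_{kl}=\kappa T_{kl}$, where $\kappa>0$ is a constant. Then $T_{kl}$ has the perfect fluid form $$T_{kl}=(p+\mu)u_ku_l+p\,g_{kl},$$ with $$\kappa p=-\frac{n-2}{2(n-1)}\,[R+\psi(n-1)],\qquad \kappa\mu=-\frac12\,\psi\,(n-1)(n-2),$$ and the equation of state $$p=\frac{\mu}{n-1}-\frac{n-2}{2(n-1)}\,\frac{R}{\kappa}$$ holds. In particular, if $n=4$ and $R=0$, then $p=\mu/3$.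
   Context: All objects are smooth, $\nabla$ is the Levi-Civita connection of $g$, and the Lorentzian signature is $(-,+,\dots,+)$. $R_{jklm}$ is the Riemann tensor, with the standard symmetries (antisymmetric in $j,k$ and in $l,m$, symmetric under exchange of pairs, first Bianchi identity). The Ricci tensor is obtained from it by the contraction $R_{ij}=R_{imj}{}^m$ (so $g^{jm}R_{jklm}=-R_{kl}$), and the scalar curvature is $R=R^m{}_m$. Indices are raised and lowered with $g$. Extended recurrent manifold: a pseudo-Riemannian manifold $(M,g)$ on which there exist a closed one-form $A_i$ (the associated covector) and nowhere vanishing scalar functions $\beta$, $\psi$ with $\nabla_j\psi=\beta A_j$ such that $$\nabla_i R_{jklm} = A_i R_{jklm} +(\beta -\psi) A_iG_{jklm} + \tfrac{\beta}{2} \left[A_j G_{iklm}+A_k G_{jilm}+A_l G_{jkim}+A_m G_{jkli}\right],$$ where $G_{jklm}= g_{mj} g_{kl} - g_{mk} g_{jl}$. *)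

theory Defs
  imports "HOL-Analysis.Analysis"
begin

section \<open>Smooth functions on open subsets of Euclidean space\<close>

definition partial :: "'n::finite \<Rightarrow> (real^'n \<Rightarrow> real) \<Rightarrow> real^'n \<Rightarrow> real" where
  "partial i f x = frechet_derivative f (at x) (axis i 1)"

primrec Ck_on :: "nat \<Rightarrow> (real^'n::finite) set \<Rightarrow> (real^'n \<Rightarrow> real) \<Rightarrow> bool" where
  "Ck_on 0 S f \<longleftrightarrow> continuous_on S f"
| "Ck_on (Suc k) S f \<longleftrightarrow> (\<forall>x\<in>S. f differentiable (at x)) \<and> (\<forall>i. Ck_on k S (partial i f))"

text \<open>Meant for open \<open>S\<close> only.\<close>

definition smooth_on :: "(real^'n::finite) set \<Rightarrow> (real^'n \<Rightarrow> real) \<Rightarrow> bool" where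
  "smooth_on S f \<longleftrightarrow> (\<forall>k. Ck_on k S f)"


section \<open>Smooth manifolds\<close>

type_synonym ('m, 'n) chart = "'m set \<times> ('m \<Rightarrow> real^'n)"

abbreviation dom_of :: "('m, 'n::finite) chart \<Rightarrow> 'm set" where
  "dom_of c \<equiv> fst c"

abbreviation coord :: "('m, 'n::finite) chart \<Rightarrow> 'm \<Rightarrow> real^'n" where
  "coord c \<equiv> snd c"

abbreviation point_at :: "('m, 'n::finite) chart \<Rightarrow> real^'n \<Rightarrow> 'm" where
  "point_at c \<equiv> inv_into (dom_of c) (coord c)"

definition is_chart :: "'m topology \<Rightarrow> ('m, 'n::finite) chart \<Rightarrow> bool" where
  "is_chart M c \<longleftrightarrow>
     openin M (dom_of c) \<and> open (coord c ` dom_of c) \<and>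
     homeomorphic_map (subtopology M (dom_of c)) (top_of_set (coord c ` dom_of c)) (coord c)"

definition smooth_transition :: "('m, 'n::finite) chart \<Rightarrow> ('m, 'n) chart \<Rightarrow> bool" where
  "smooth_transition c c' \<longleftrightarrow>
     (\<forall>i. smooth_on (coord c ` (dom_of c \<inter> dom_of c')) (\<lambda>y. coord c' (point_at c y) $ i))"

text \<open>The smooth structure is given by an atlas \<open>\<A>\<close>, which need not be maximal; the dimension is
  the cardinality of the index type.\<close>

definition smooth_manifold :: "'m topology \<Rightarrow> ('m, 'n::finite) chart set \<Rightarrow> bool" where
  "smooth_manifold M \<A> \<longleftrightarrow>
     Hausdorff_space M \<and> second_countable M \<and>
     (\<forall>c\<in>\<A>. is_chart M c) \<and> (\<Union>c\<in>\<A>. dom_of c) = topspace M \<and>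
     (\<forall>c\<in>\<A>. \<forall>c'\<in>\<A>. smooth_transition c c')"

definition smooth_in :: "('m, 'n::finite) chart \<Rightarrow> ('m \<Rightarrow> real) \<Rightarrow> bool" where
  "smooth_in c f \<longleftrightarrow> smooth_on (coord c ` dom_of c) (\<lambda>y. f (point_at c y))"

definition smooth_scalar :: "('m, 'n::finite) chart set \<Rightarrow> ('m \<Rightarrow> real) \<Rightarrow> bool" where
  "smooth_scalar \<A> f \<longleftrightarrow> (\<forall>c\<in>\<A>. smooth_in c f)"

text \<open>The coordinate derivation \<open>\<partial>/\<partial>x\<^sup>i\<close> of the chart \<open>c\<close>, applied to \<open>f\<close> at the point \<open>x\<close> of
  the manifold.\<close>

definition pd :: "('m, 'n::finite) chart \<Rightarrow> 'n \<Rightarrow> ('m \<Rightarrow> real) \<Rightarrow> 'm \<Rightarrow> real" where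
  "pd c i f x = partial i (\<lambda>y. f (point_at c y)) (coord c x)"


section \<open>Covariant tensor fields, given by their components in each chart\<close>

type_synonym ('m, 'n) tensor1 = "('m, 'n) chart \<Rightarrow> 'm \<Rightarrow> 'n \<Rightarrow> real"
type_synonym ('m, 'n) tensor2 = "('m, 'n) chart \<Rightarrow> 'm \<Rightarrow> 'n \<Rightarrow> 'n \<Rightarrow> real"

text \<open>\<open>jac c c' x a i\<close> is \<open>\<partial>x\<^sup>a/\<partial>x'\<^sup>i\<close>, where \<open>x\<close> and \<open>x'\<close> are the coordinates of \<open>c\<close> and \<open>c'\<close>.\<close>

definition jac :: "('m, 'n::finite) chart \<Rightarrow> ('m, 'n) chart \<Rightarrow> 'm \<Rightarrow> 'n \<Rightarrow> 'n \<Rightarrow> real" where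
  "jac c c' x a i = pd c' i (\<lambda>y. coord c y $ a) x"

definition one_form :: "('m, 'n::finite) chart set \<Rightarrow> ('m, 'n) tensor1 \<Rightarrow> bool" where
  "one_form \<A> A \<longleftrightarrow>
     (\<forall>c\<in>\<A>. \<forall>i. smooth_in c (\<lambda>x. A c x i)) \<and>
     (\<forall>c\<in>\<A>. \<forall>c'\<in>\<A>. \<forall>x\<in>dom_of c \<inter> dom_of c'. \<forall>i.
        A c' x i = (\<Sum>a\<in>UNIV. jac c c' x a i * A c x a))"

definition closed_form :: "('m, 'n::finite) chart set \<Rightarrow> ('m, 'n) tensor1 \<Rightarrow> bool" where
  "closed_form \<A> A \<longleftrightarrow>
     (\<forall>c\<in>\<A>. \<forall>x\<in>dom_of c. \<forall>i j. pd c i (\<lambda>y. A c y j) x = pd c j (\<lambda>y. A c y i) x)"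

definition two_tensor :: "('m, 'n::finite) chart set \<Rightarrow> ('m, 'n) tensor2 \<Rightarrow> bool" where
  "two_tensor \<A> t \<longleftrightarrow>
     (\<forall>c\<in>\<A>. \<forall>i j. smooth_in c (\<lambda>x. t c x i j)) \<and>
     (\<forall>c\<in>\<A>. \<forall>c'\<in>\<A>. \<forall>x\<in>dom_of c \<inter> dom_of c'. \<forall>i j.
        t c' x i j = (\<Sum>a\<in>UNIV. \<Sum>b\<in>UNIV. jac c c' x a i * jac c c' x b j * t c x a b))"


section \<open>Pseudo-Riemannian geometry\<close>

definition metric_matrix ::
  "('m, 'n::finite) tensor2 \<Rightarrow> ('m, 'n) chart \<Rightarrow> 'm \<Rightarrow> real^'n^'n" where
  "metric_matrix g c x = (\<chi> i j. g c x i j)"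

definition inv_metric ::
  "('m, 'n::finite) tensor2 \<Rightarrow> ('m, 'n) chart \<Rightarrow> 'm \<Rightarrow> 'n \<Rightarrow> 'n \<Rightarrow> real" where
  "inv_metric g c x i j = matrix_inv (metric_matrix g c x) $ i $ j"

definition pseudo_riemannian_metric ::
  "('m, 'n::finite) chart set \<Rightarrow> ('m, 'n) tensor2 \<Rightarrow> bool" where
  "pseudo_riemannian_metric \<A> g \<longleftrightarrow>
     two_tensor \<A> g \<and>
     (\<forall>c\<in>\<A>. \<forall>x\<in>dom_of c. (\<forall>i j. g c x i j = g c x j i) \<and> invertible (metric_matrix g c x))"

text \<open>Signature \<open>(-,+,\<dots>,+)\<close>: at every point there is a frame (the columns of \<open>P\<close>) in which the
  metric is diagonal with exactly one entry \<open>-1\<close> and all others \<open>+1\<close>.\<close>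

definition lorentzian :: "('m, 'n::finite) chart set \<Rightarrow> ('m, 'n) tensor2 \<Rightarrow> bool" where
  "lorentzian \<A> g \<longleftrightarrow>
     (\<forall>c\<in>\<A>. \<forall>x\<in>dom_of c. \<exists>(P :: real^'n^'n) t. invertible P \<and>
        transpose P ** metric_matrix g c x ** P =
          (\<chi> a b. if a = b then (if a = t then - 1 else 1) else 0))"

text \<open>Christoffel symbols \<open>\<Gamma>\<^sup>k\<^sub>i\<^sub>j\<close> of the Levi-Civita connection.\<close>

definition christoffel ::
  "('m, 'n::finite) tensor2 \<Rightarrow> ('m, 'n) chart \<Rightarrow> 'm \<Rightarrow> 'n \<Rightarrow> 'n \<Rightarrow> 'n \<Rightarrow> real" where
  "christoffel g c x k i j =
     1/2 * (\<Sum>l\<in>UNIV. inv_metric g c x k l *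
       (pd c i (\<lambda>y. g c y j l) x + pd c j (\<lambda>y. g c y i l) x - pd c l (\<lambda>y. g c y i j) x))"

definition riemann_up ::
  "('m, 'n::finite) tensor2 \<Rightarrow> ('m, 'n) chart \<Rightarrow> 'm \<Rightarrow> 'n \<Rightarrow> 'n \<Rightarrow> 'n \<Rightarrow> 'n \<Rightarrow> real" where
  "riemann_up g c x a b k l =
     pd c k (\<lambda>y. christoffel g c y a l b) x - pd c l (\<lambda>y. christoffel g c y a k b) x
     + (\<Sum>e\<in>UNIV. christoffel g c x a k e * christoffel g c x e l b)
     - (\<Sum>e\<in>UNIV. christoffel g c x a l e * christoffel g c x e k b)"

text \<open>Sign convention: \<open>R\<^sub>j\<^sub>k\<^sub>j\<^sub>k > 0\<close> on round spheres, that is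
  \<open>R\<^sub>j\<^sub>k\<^sub>l\<^sub>m = g\<^sub>j\<^sub>l g\<^sub>k\<^sub>m - g\<^sub>j\<^sub>m g\<^sub>k\<^sub>l\<close> on the unit sphere; with the contraction
  \<open>R\<^sub>i\<^sub>j = g\<^sup>m\<^sup>l R\<^sub>i\<^sub>m\<^sub>j\<^sub>l\<close> the Ricci tensor of a sphere is positive, as usual in
  Einstein's equations.\<close>

definition riemann ::
  "('m, 'n::finite) tensor2 \<Rightarrow> ('m, 'n) chart \<Rightarrow> 'm \<Rightarrow> 'n \<Rightarrow> 'n \<Rightarrow> 'n \<Rightarrow> 'n \<Rightarrow> real" where
  "riemann g c x j k l m = (\<Sum>a\<in>UNIV. g c x j a * riemann_up g c x a k l m)"

definition ricci ::
  "('m, 'n::finite) tensor2 \<Rightarrow> ('m, 'n) chart \<Rightarrow> 'm \<Rightarrow> 'n \<Rightarrow> 'n \<Rightarrow> real" where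
  "ricci g c x i j = (\<Sum>m\<in>UNIV. \<Sum>l\<in>UNIV. inv_metric g c x m l * riemann g c x i m j l)"

definition scalar_curv ::
  "('m, 'n::finite) tensor2 \<Rightarrow> ('m, 'n) chart \<Rightarrow> 'm \<Rightarrow> real" where
  "scalar_curv g c x = (\<Sum>i\<in>UNIV. \<Sum>j\<in>UNIV. inv_metric g c x i j * ricci g c x i j)"

text \<open>\<open>cov_deriv4 g c t x i j k l m\<close> is \<open>\<nabla>\<^sub>i t\<^sub>j\<^sub>k\<^sub>l\<^sub>m\<close>, where \<open>t\<close> holds the components in the chart
  \<open>c\<close> of a covariant tensor field of rank four.\<close>

definition cov_deriv4 ::
  "('m, 'n::finite) tensor2 \<Rightarrow> ('m, 'n) chart \<Rightarrow> ('m \<Rightarrow> 'n \<Rightarrow> 'n \<Rightarrow> 'n \<Rightarrow> 'n \<Rightarrow> real) \<Rightarrow>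
     'm \<Rightarrow> 'n \<Rightarrow> 'n \<Rightarrow> 'n \<Rightarrow> 'n \<Rightarrow> 'n \<Rightarrow> real" where
  "cov_deriv4 g c t x i j k l m =
     pd c i (\<lambda>y. t y j k l m) x
     - (\<Sum>a\<in>UNIV. christoffel g c x a i j * t x a k l m)
     - (\<Sum>a\<in>UNIV. christoffel g c x a i k * t x j a l m)
     - (\<Sum>a\<in>UNIV. christoffel g c x a i l * t x j k a m)
     - (\<Sum>a\<in>UNIV. christoffel g c x a i m * t x j k l a)"

definition norm_sq ::
  "('m, 'n::finite) tensor2 \<Rightarrow> ('m, 'n) tensor1 \<Rightarrow> ('m, 'n) chart \<Rightarrow> 'm \<Rightarrow> real" where
  "norm_sq g A c x = (\<Sum>i\<in>UNIV. \<Sum>j\<in>UNIV. inv_metric g c x i j * A c x i * A c x j)"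


section \<open>Extended recurrent manifolds\<close>

definition G_tensor ::
  "('m, 'n::finite) tensor2 \<Rightarrow> ('m, 'n) chart \<Rightarrow> 'm \<Rightarrow> 'n \<Rightarrow> 'n \<Rightarrow> 'n \<Rightarrow> 'n \<Rightarrow> real" where
  "G_tensor g c x j k l m = g c x m j * g c x k l - g c x m k * g c x j l"

definition extended_recurrent_manifold ::
  "'m topology \<Rightarrow> ('m, 'n::finite) chart set \<Rightarrow> ('m, 'n) tensor2 \<Rightarrow> ('m, 'n) tensor1 \<Rightarrow>
     ('m \<Rightarrow> real) \<Rightarrow> ('m \<Rightarrow> real) \<Rightarrow> bool" where
  "extended_recurrent_manifold M \<A> g A \<beta> \<psi> \<longleftrightarrow>
     smooth_manifold M \<A> \<and> pseudo_riemannian_metric \<A> g \<and>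
     one_form \<A> A \<and> closed_form \<A> A \<and>
     smooth_scalar \<A> \<beta> \<and> smooth_scalar \<A> \<psi> \<and>
     (\<forall>x\<in>topspace M. \<beta> x \<noteq> 0 \<and> \<psi> x \<noteq> 0) \<and>
     (\<forall>c\<in>\<A>. \<forall>x\<in>dom_of c. \<forall>j. pd c j \<psi> x = \<beta> x * A c x j) \<and>
     (\<forall>c\<in>\<A>. \<forall>x\<in>dom_of c. \<forall>i j k l m.
        cov_deriv4 g c (riemann g c) x i j k l m =
          A c x i * riemann g c x j k l m
          + (\<beta> x - \<psi> x) * A c x i * G_tensor g c x j k l m
          + \<beta> x / 2 *
              (A c x j * G_tensor g c x i k l m + A c x k * G_tensor g c x j i l m
               + A c x l * G_tensor g c x j k i m + A c x m * G_tensor g c x j k l i))"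

end

theory Submission
  imports Defs
begin

text \<open>Put \<open>K = R - \<psi> G\<close>. The second Bianchi identity turns the recurrence into
  \<open>A\<^sub>i K\<^sub>j\<^sub>k\<^sub>l\<^sub>m + A\<^sub>l K\<^sub>j\<^sub>k\<^sub>m\<^sub>i + A\<^sub>m K\<^sub>j\<^sub>k\<^sub>i\<^sub>l = 0\<close>, so that \<open>K\<close> is determined by \<open>A\<close> and the symmetric
  form \<open>Q\<^sub>k\<^sub>m = A\<^sup>i A\<^sup>j K\<^sub>j\<^sub>k\<^sub>i\<^sub>m\<close>. Differentiating this identity covariantly, with \<open>B = \<nabla>A\<close>, and
  contracting twice with \<open>A\<close> gives, for \<open>X, Y, Z\<close> orthogonal to \<open>A\<close>,
  \<open>B(U,X) Q(Y,Z) - B(U,Y) Q(X,Z) = \<gamma> (g(U,X) g(Y,Z) - g(U,Y) g(X,Z))\<close> with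
  \<open>\<gamma> = - \<beta> (A\<^sup>2)\<^sup>2 / 2 \<noteq> 0\<close>. As the orthogonal complement of \<open>A\<close> has dimension at least three, both
  \<open>Q\<close> and \<open>B\<close> are multiples of \<open>g\<close> there, and contracting \<open>R = K + \<psi> G\<close> shows that the Ricci tensor
  is a combination of \<open>g\<close> and \<open>A \<otimes> A\<close> whose coefficients are fixed by \<open>\<psi>\<close> and the scalar curvature.

  That \<open>p\<close> is a function on the manifold requires the scalar curvature to be independent of the
  chart. The factor of \<open>Q\<close> is \<open>\<gamma> g(U,X) / B(U,X)\<close>, so it suffices that \<open>\<nabla>A\<close> is a tensor, which
  involves only second derivatives of the transition maps.\<close>

section \<open>Partial derivatives and smooth functions\<close>

lemma partial_eqI: "(f has_derivative f') (at x) \<Longrightarrow> partial i f x = f' (axis i 1)"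
  unfolding partial_def by (metis frechet_derivative_at)

lemma has_derivative_cong_open:
  assumes "open S" "x \<in> S" "\<And>y. y \<in> S \<Longrightarrow> f y = g y"
  shows "(f has_derivative D) (at x) \<longleftrightarrow> (g has_derivative D) (at x)"
  using has_derivative_transform_within_open[of f D x UNIV S g]
    has_derivative_transform_within_open[of g D x UNIV S f] assms by auto

text \<open>Holds for arbitrary functions: \<open>frechet_derivative\<close> is a choice among the
  derivatives at \<open>x\<close>, and functions agreeing near \<open>x\<close> have the same
  ones.\<close>

lemma partial_cong:
  assumes "open S" "x \<in> S" "\<And>y. y \<in> S \<Longrightarrow> f y = g y"
  shows "partial i f x = partial i g x"
  unfolding partial_def frechet_derivative_def
  by (simp only: has_derivative_cong_open[OF assms])

lemma differentiable_cong_open: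
  assumes "open S" "x \<in> S" "\<And>y. y \<in> S \<Longrightarrow> f y = g y"
  shows "f differentiable (at x) \<longleftrightarrow> g differentiable (at x)"
  unfolding differentiable_def by (simp only: has_derivative_cong_open[OF assms])

lemma Ck_on_cong:
  assumes "open S" "\<And>y. y \<in> S \<Longrightarrow> f y = g y"
  shows "Ck_on k S f \<longleftrightarrow> Ck_on k S g"
  using assms(2)
proof (induction k arbitrary: f g)
  case 0
  then show ?case by (simp cong: continuous_on_cong)
next
  case (Suc k)
  have "Ck_on k S (partial i f) \<longleftrightarrow> Ck_on k S (partial i g)" for i
    by (rule Suc.IH) (rule partial_cong[OF assms(1) _ Suc.prems])
  moreover have "f differentiable (at x) \<longleftrightarrow> g differentiable (at x)" if "x \<in> S" for x
    by (rule differentiable_cong_open[OF assms(1) that Suc.prems])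
  ultimately show ?case by simp
qed

lemma Ck_on_Suc_imp: "Ck_on (Suc k) S f \<Longrightarrow> Ck_on k S f"
proof (induction k arbitrary: f)
  case 0
  then show ?case
    by (auto intro!: differentiable_imp_continuous_on simp: differentiable_on_def
        differentiable_at_withinI)
next
  case (Suc k)
  then show ?case by (metis Ck_on.simps(2))
qed

lemma partial_const: "partial i (\<lambda>x. c) = (\<lambda>x. 0)"
  by (simp add: partial_def fun_eq_iff)

lemma partial_add:
  assumes "f differentiable (at x)" "h differentiable (at x)"
  shows "partial i (\<lambda>y. f y + h y) x = partial i f x + partial i h x"
  using partial_eqI[OF has_derivative_add[OF assms[unfolded frechet_derivative_works]]]
  by (simp add: partial_def)

lemma partial_mult:
  fixes f h :: "real^'n::finite \<Rightarrow> real"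
  assumes "f differentiable (at x)" "h differentiable (at x)"
  shows "partial i (\<lambda>y. f y * h y) x = f x * partial i h x + partial i f x * h x"
  using partial_eqI[OF has_derivative_mult[OF assms[unfolded frechet_derivative_works]]]
  by (simp add: partial_def)

lemma partial_inverse:
  fixes f :: "real^'n::finite \<Rightarrow> real"
  assumes "f differentiable (at x)" "f x \<noteq> 0"
  shows "partial i (\<lambda>y. inverse (f y)) x = (- partial i f x) * (inverse (f x) * inverse (f x))"
  using partial_eqI[OF Deriv.has_derivative_inverse[OF assms(2) assms(1)[unfolded frechet_derivative_works]]]
  by (simp add: partial_def)

lemma Ck_on_const: "Ck_on k S (\<lambda>x. c)"
  by (induction k arbitrary: c) (auto simp: partial_const)

lemma Ck_on_add:
  assumes "open S"
  shows "Ck_on k S f \<Longrightarrow> Ck_on k S h \<Longrightarrow> Ck_on k S (\<lambda>x. f x + h x)"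
proof (induction k arbitrary: f h)
  case 0
  then show ?case by (simp add: continuous_intros)
next
  case (Suc k)
  have "Ck_on k S (partial i (\<lambda>x. f x + h x))" for i
  proof -
    have "Ck_on k S (\<lambda>x. partial i f x + partial i h x)"
      using Suc by simp
    then show ?thesis
      by (rule Ck_on_cong[OF assms, THEN iffD2, rotated]) (use Suc in \<open>auto intro: partial_add\<close>)
  qed
  then show ?case using Suc by auto
qed

text \<open>The Leibniz rule gives partial derivatives that are sums of products of functions of
  order \<open>k\<close>, once \<open>f\<close> and \<open>h\<close> themselves are downgraded from
  \<open>Suc k\<close> to \<open>k\<close>.\<close>

lemma Ck_on_mult:
  assumes "open S"
  shows "Ck_on k S f \<Longrightarrow> Ck_on k S h \<Longrightarrow> Ck_on k S (\<lambda>x. f x * h x)"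
proof (induction k arbitrary: f h)
  case 0
  then show ?case by (simp add: continuous_intros)
next
  case (Suc k)
  have "Ck_on k S (partial i (\<lambda>x. f x * h x))" for i
  proof -
    have "Ck_on k S (\<lambda>x. f x * partial i h x + partial i f x * h x)"
      using Suc.prems Ck_on_Suc_imp[OF Suc.prems(1)] Ck_on_Suc_imp[OF Suc.prems(2)]
      by (intro Ck_on_add[OF assms] Suc.IH) simp_all
    then show ?thesis
      by (rule Ck_on_cong[OF assms, THEN iffD2, rotated]) (use Suc in \<open>auto intro: partial_mult\<close>)
  qed
  then show ?case using Suc by auto
qed

text \<open>The derivative of \<open>1/f\<close> is \<open>-f'\<close> times two copies of
  \<open>1/f\<close>, so the induction needs only closure under products.\<close>

lemma Ck_on_inverse:
  assumes "open S" "\<And>x. x \<in> S \<Longrightarrow> f x \<noteq> 0"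
  shows "Ck_on k S f \<Longrightarrow> Ck_on k S (\<lambda>x. inverse (f x))"
proof (induction k)
  case 0
  then show ?case using assms by (simp add: continuous_intros)
next
  case (Suc k)
  have *: "Ck_on k S (\<lambda>x. inverse (f x))" using Suc Ck_on_Suc_imp by blast
  have "Ck_on k S (partial i (\<lambda>x. inverse (f x)))" for i
  proof -
    have "Ck_on k S (\<lambda>x. ((-1) * partial i f x) * (inverse (f x) * inverse (f x)))"
      using Suc * by (intro Ck_on_mult[OF assms(1)] Ck_on_const) auto
    then show ?thesis
      by (rule Ck_on_cong[OF assms(1), THEN iffD2, rotated])
        (use Suc assms(2) in \<open>auto simp: partial_inverse\<close>)
  qed
  then show ?case using Suc assms(2) by (auto intro: differentiable_inverse)
qed

lemma smooth_on_cong: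
  "open S \<Longrightarrow> (\<And>y. y \<in> S \<Longrightarrow> f y = g y) \<Longrightarrow> smooth_on S f \<longleftrightarrow> smooth_on S g"
  unfolding smooth_on_def using Ck_on_cong by blast

lemma smooth_on_partial: "smooth_on S f \<Longrightarrow> smooth_on S (partial i f)"
  unfolding smooth_on_def by (metis Ck_on.simps(2))

lemma smooth_on_differentiable: "smooth_on S f \<Longrightarrow> x \<in> S \<Longrightarrow> f differentiable (at x)"
  unfolding smooth_on_def by (metis Ck_on.simps(2))

lemma smooth_on_continuous: "smooth_on S f \<Longrightarrow> continuous_on S f"
  unfolding smooth_on_def by (metis Ck_on.simps(1))

section \<open>Equality of mixed partial derivatives\<close>

lemma partial_along_axis:
  fixes f :: "real^'n::finite \<Rightarrow> real"
  assumes "f differentiable (at (p + s *\<^sub>R axis i 1))"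
  shows "((\<lambda>s. f (p + s *\<^sub>R axis i 1)) has_real_derivative partial i f (p + s *\<^sub>R axis i 1)) (at s)"
proof -
  let ?D = "frechet_derivative f (at (p + s *\<^sub>R axis i 1))"
  have "(f has_derivative ?D) (at (p + s *\<^sub>R axis i 1))"
    using assms frechet_derivative_works by blast
  moreover have "((\<lambda>s. p + s *\<^sub>R axis i 1) has_derivative (\<lambda>t. t *\<^sub>R axis i 1)) (at s)"
    by (auto intro!: derivative_eq_intros)
  ultimately have "((\<lambda>s. f (p + s *\<^sub>R axis i 1)) has_derivative (\<lambda>t. ?D (t *\<^sub>R axis i 1))) (at s)"
    using has_derivative_compose by blast
  moreover have "(\<lambda>t. ?D (t *\<^sub>R axis i 1)) = (*) (partial i f (p + s *\<^sub>R axis i 1))"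
    using linear_cmul[OF linear_frechet_derivative[OF assms]]
    by (simp add: partial_def fun_eq_iff mult.commute)
  ultimately show ?thesis
    unfolding has_field_derivative_def by simp
qed

text \<open>The left-hand side is symmetric in \<open>i\<close> and \<open>j\<close>, so that \<open>h \<rightarrow> 0\<close> identifies the two mixed
  derivatives.\<close>

lemma second_difference_mvt:
  fixes f :: "real^'n::finite \<Rightarrow> real"
  assumes S: "cball x (2 * h) \<subseteq> S" "h > 0"
    and f: "\<And>y. y \<in> S \<Longrightarrow> f differentiable (at y)"
    and fi: "\<And>y. y \<in> S \<Longrightarrow> partial i f differentiable (at y)"
  shows "\<exists>z\<in>cball x (2 * h). f (x + h *\<^sub>R axis i 1 + h *\<^sub>R axis j 1) - f (x + h *\<^sub>R axis i 1)
      - f (x + h *\<^sub>R axis j 1) + f x = h * h * partial j (partial i f) z"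
proof -
  let ?a = "axis i (1::real)" and ?b = "axis j (1::real)"
  have inS: "x + s *\<^sub>R ?a + t *\<^sub>R ?b \<in> cball x (2 * h)" if "0 \<le> s" "s \<le> h" "0 \<le> t" "t \<le> h" for s t
  proof -
    have "norm (s *\<^sub>R ?a + t *\<^sub>R ?b) \<le> s * norm ?a + t * norm ?b"
      using that norm_triangle_ineq[of "s *\<^sub>R ?a" "t *\<^sub>R ?b"] by simp
    also have "\<dots> \<le> 2 * h" using that by (simp add: norm_axis_1)
    finally show ?thesis by (metis add.assoc add_diff_cancel_left' dist_commute dist_norm mem_cball)
  qed
  note D = partial_along_axis[OF f] and D2 = partial_along_axis[OF fi]
  \<comment> \<open>The first mean value step runs in direction \<open>i\<close>, on the difference
    of \<open>f\<close> along two parallel segments \<open>h\<close> apart in direction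
    \<open>j\<close>; the second runs in direction \<open>j\<close> on
    \<open>partial i f\<close>.\<close>
  have "\<exists>s>0. s < h \<and> (\<lambda>s. f (x + h *\<^sub>R ?b + s *\<^sub>R ?a) - f (x + s *\<^sub>R ?a)) h
      - (\<lambda>s. f (x + h *\<^sub>R ?b + s *\<^sub>R ?a) - f (x + s *\<^sub>R ?a)) 0
      = (h - 0) * (partial i f (x + h *\<^sub>R ?b + s *\<^sub>R ?a) - partial i f (x + s *\<^sub>R ?a))"
  proof (rule MVT2)
    fix s assume s: "0 \<le> s" "s \<le> h"
    have "x + h *\<^sub>R ?b + s *\<^sub>R ?a \<in> S" "x + s *\<^sub>R ?a \<in> S"
      using inS[of s h] inS[of s 0] s S by (auto simp: add_ac)
    then show "((\<lambda>s. f (x + h *\<^sub>R ?b + s *\<^sub>R ?a) - f (x + s *\<^sub>R ?a)) has_real_derivative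
       partial i f (x + h *\<^sub>R ?b + s *\<^sub>R ?a) - partial i f (x + s *\<^sub>R ?a)) (at s)"
      by (intro DERIV_diff D)
  qed (use S in auto)
  then obtain s where s: "0 < s" "s < h" and e1:
    "f (x + h *\<^sub>R ?b + h *\<^sub>R ?a) - f (x + h *\<^sub>R ?a) - (f (x + h *\<^sub>R ?b) - f x)
      = h * (partial i f (x + h *\<^sub>R ?b + s *\<^sub>R ?a) - partial i f (x + s *\<^sub>R ?a))"
    by auto
  have "\<exists>t>0. t < h \<and> partial i f (x + s *\<^sub>R ?a + h *\<^sub>R ?b) - partial i f (x + s *\<^sub>R ?a + 0 *\<^sub>R ?b)
      = (h - 0) * partial j (partial i f) (x + s *\<^sub>R ?a + t *\<^sub>R ?b)"
  proof (rule MVT2)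
    fix t assume t: "0 \<le> t" "t \<le> h"
    have "x + s *\<^sub>R ?a + t *\<^sub>R ?b \<in> S"
      using inS[of s t] s t S by auto
    then show "((\<lambda>t. partial i f (x + s *\<^sub>R ?a + t *\<^sub>R ?b)) has_real_derivative
       partial j (partial i f) (x + s *\<^sub>R ?a + t *\<^sub>R ?b)) (at t)"
      by (rule D2)
  qed (use S in auto)
  then obtain t where t: "0 < t" "t < h" and e2:
     "partial i f (x + s *\<^sub>R ?a + h *\<^sub>R ?b) - partial i f (x + s *\<^sub>R ?a)
      = h * partial j (partial i f) (x + s *\<^sub>R ?a + t *\<^sub>R ?b)"
    by auto
  show ?thesis
  proof
    show "x + s *\<^sub>R ?a + t *\<^sub>R ?b \<in> cball x (2 * h)" using inS s t by simp
    show "f (x + h *\<^sub>R axis i 1 + h *\<^sub>R axis j 1) - f (x + h *\<^sub>R axis i 1)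
      - f (x + h *\<^sub>R axis j 1) + f x = h * h * partial j (partial i f) (x + s *\<^sub>R ?a + t *\<^sub>R ?b)"
      using e1 e2 by (simp add: add_ac)
  qed
qed

lemma partial_commute:
  fixes f :: "real^'n::finite \<Rightarrow> real"
  assumes S: "open S" "x \<in> S" and f: "smooth_on S f"
  shows "partial i (partial j f) x = partial j (partial i f) x"
proof -
  have c: "isCont (partial i (partial j f)) x" for i j
    using f S smooth_on_continuous smooth_on_partial continuous_on_eq_continuous_at by metis
  have close: "\<bar>partial i (partial j f) x - partial j (partial i f) x\<bar> < 2 * e" if e: "e > 0" for e
  proof -
    obtain d0 where d0: "d0 > 0" "cball x d0 \<subseteq> S" using S open_contains_cball by blast
    obtain d1 where d1: "d1 > 0" "\<And>y. dist y x < d1 \<Longrightarrow>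
        dist (partial i (partial j f) y) (partial i (partial j f) x) < e"
      using c[of i j] e unfolding continuous_at_eps_delta by blast
    obtain d2 where d2: "d2 > 0" "\<And>y. dist y x < d2 \<Longrightarrow>
        dist (partial j (partial i f) y) (partial j (partial i f) x) < e"
      using c[of j i] e unfolding continuous_at_eps_delta by blast
    \<comment> \<open>The mean value points lie within \<open>2 * h\<close>, half of the least
      radius, hence strictly inside all three balls.\<close>
    define h where "h = min d0 (min d1 d2) / 4"
    have h: "h > 0" "2 * h < d0" "2 * h < d1" "2 * h < d2" using d0 d1 d2 by (auto simp: h_def)
    have hS: "cball x (2 * h) \<subseteq> S" using h d0 by (auto simp: subset_eq)
    have df: "\<And>y. y \<in> S \<Longrightarrow> f differentiable (at y)"
      "\<And>y k. y \<in> S \<Longrightarrow> partial k f differentiable (at y)"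
      using f smooth_on_differentiable smooth_on_partial by blast+
    obtain z where z: "z \<in> cball x (2 * h)"
      "f (x + h *\<^sub>R axis i 1 + h *\<^sub>R axis j 1) - f (x + h *\<^sub>R axis i 1)
      - f (x + h *\<^sub>R axis j 1) + f x = h * h * partial j (partial i f) z"
      using second_difference_mvt[OF hS h(1) df, of i j] by blast
    obtain w where w: "w \<in> cball x (2 * h)"
      "f (x + h *\<^sub>R axis j 1 + h *\<^sub>R axis i 1) - f (x + h *\<^sub>R axis j 1)
      - f (x + h *\<^sub>R axis i 1) + f x = h * h * partial i (partial j f) w"
      using second_difference_mvt[OF hS h(1) df, of j i] by blast
    have "f (x + h *\<^sub>R axis j 1 + h *\<^sub>R axis i 1) = f (x + h *\<^sub>R axis i 1 + h *\<^sub>R axis j 1)"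
      by (simp add: add_ac)
    then have "h * h * partial j (partial i f) z = h * h * partial i (partial j f) w"
      using z(2) w(2) by linarith
    then have eq: "partial j (partial i f) z = partial i (partial j f) w" using h(1) by simp
    have "dist z x < d2" "dist w x < d1" using z(1) w(1) h by (auto simp: dist_commute)
    then show ?thesis using d1(2)[of w] d2(2)[of z] eq by (auto simp: dist_real_def)
  qed
  show ?thesis
  proof (rule ccontr)
    assume "\<not> ?thesis"
    then have "\<bar>partial i (partial j f) x - partial j (partial i f) x\<bar> > 0" by simp
    then show False
      using close[of "\<bar>partial i (partial j f) x - partial j (partial i f) x\<bar> / 2"] by simp
  qed
qed

section \<open>Differentiation in a chart\<close>

lemma smooth_on_const: "smooth_on S (\<lambda>x. c)"
  by (simp add: smooth_on_def Ck_on_const)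

lemma smooth_on_add: "open S \<Longrightarrow> smooth_on S f \<Longrightarrow> smooth_on S h \<Longrightarrow> smooth_on S (\<lambda>x. f x + h x)"
  by (simp add: smooth_on_def Ck_on_add)

lemma smooth_on_mult: "open S \<Longrightarrow> smooth_on S f \<Longrightarrow> smooth_on S h \<Longrightarrow> smooth_on S (\<lambda>x. f x * h x)"
  by (simp add: smooth_on_def Ck_on_mult)

lemma smooth_on_inverse:
  "open S \<Longrightarrow> (\<And>x. x \<in> S \<Longrightarrow> f x \<noteq> 0) \<Longrightarrow> smooth_on S f \<Longrightarrow> smooth_on S (\<lambda>x. inverse (f x))"
  by (simp add: smooth_on_def Ck_on_inverse)

text \<open>Pointwise, because entries of \<open>jac\<close> are controlled only on the overlap of
  two charts, where \<open>smooth_in\<close> would ask for the whole domain.\<close>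

definition differentiable_in :: "('m, 'n::finite) chart \<Rightarrow> ('m \<Rightarrow> real) \<Rightarrow> 'm \<Rightarrow> bool" where
  "differentiable_in c f x \<longleftrightarrow> (\<lambda>y. f (point_at c y)) differentiable (at (coord c x))"

lemma is_chart_open: "is_chart M c \<Longrightarrow> open (coord c ` dom_of c)"
  by (simp add: is_chart_def)

lemma is_chart_inj: "is_chart M c \<Longrightarrow> inj_on (coord c) (dom_of c)"
  unfolding is_chart_def homeomorphic_eq_everything_map
  using openin_subset[of M "dom_of c"] by (auto simp: topspace_subtopology Int_absorb1)

lemma point_at_coord: "is_chart M c \<Longrightarrow> x \<in> dom_of c \<Longrightarrow> point_at c (coord c x) = x"
  by (simp add: is_chart_inj)

lemma is_chart_open_image:
  assumes "is_chart M c" "openin M V"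
  shows "open (coord c ` (dom_of c \<inter> V))"
proof -
  have "open_map (subtopology M (dom_of c)) (top_of_set (coord c ` dom_of c)) (coord c)"
    using assms(1) by (simp add: is_chart_def homeomorphic_imp_open_map)
  moreover have "openin (subtopology M (dom_of c)) (dom_of c \<inter> V)"
    using assms by (simp add: openin_subtopology_Int2)
  ultimately show ?thesis
    using is_chart_open[OF assms(1)] openin_open_trans unfolding open_map_def by blast
qed

lemma differentiable_in_const: "differentiable_in c (\<lambda>y. r) x"
  by (simp add: differentiable_in_def)

lemma differentiable_in_add:
  "differentiable_in c f x \<Longrightarrow> differentiable_in c h x \<Longrightarrow> differentiable_in c (\<lambda>y. f y + h y) x"
  by (simp add: differentiable_in_def)

lemma differentiable_in_mult:
  "differentiable_in c f x \<Longrightarrow> differentiable_in c h x \<Longrightarrow> differentiable_in c (\<lambda>y. f y * h y) x"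
  by (simp add: differentiable_in_def)

lemma differentiable_in_minus:
  "differentiable_in c f x \<Longrightarrow> differentiable_in c (\<lambda>y. - f y) x"
  by (simp add: differentiable_in_def)

lemma differentiable_in_diff:
  "differentiable_in c f x \<Longrightarrow> differentiable_in c h x \<Longrightarrow> differentiable_in c (\<lambda>y. f y - h y) x"
  by (simp add: differentiable_in_def)

lemma differentiable_in_sum:
  "(\<And>a. a \<in> I \<Longrightarrow> differentiable_in c (f a) x) \<Longrightarrow> differentiable_in c (\<lambda>y. \<Sum>a\<in>I. f a y) x"
  by (induction I rule: infinite_finite_induct)
    (auto intro: differentiable_in_const differentiable_in_add)

lemmas differentiable_in_intros = differentiable_in_const differentiable_in_add
  differentiable_in_mult differentiable_in_minus differentiable_in_diff differentiable_in_sum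

lemma pd_const: "pd c i (\<lambda>y. r) x = 0"
  by (simp add: pd_def partial_const)

lemma pd_add:
  "differentiable_in c f x \<Longrightarrow> differentiable_in c h x \<Longrightarrow>
    pd c i (\<lambda>y. f y + h y) x = pd c i f x + pd c i h x"
  by (simp add: differentiable_in_def pd_def partial_add)

lemma pd_mult:
  assumes "is_chart M c" "x \<in> dom_of c" "differentiable_in c f x" "differentiable_in c h x"
  shows "pd c i (\<lambda>y. f y * h y) x = f x * pd c i h x + pd c i f x * h x"
  using assms(3,4) point_at_coord[OF assms(1,2)]
  by (simp add: differentiable_in_def pd_def partial_mult)

lemma pd_cmult:
  assumes "differentiable_in c f x"
  shows "pd c i (\<lambda>y. r * f y) x = r * pd c i f x"
  using assms partial_mult[of "\<lambda>_. r" "coord c x" "\<lambda>y. f (point_at c y)" i]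
  by (simp add: differentiable_in_def pd_def partial_const)

lemma pd_minus:
  assumes "differentiable_in c f x"
  shows "pd c i (\<lambda>y. - f y) x = - pd c i f x"
  using pd_cmult[OF assms, of i "-1"] by simp

lemma pd_diff:
  assumes "differentiable_in c f x" "differentiable_in c h x"
  shows "pd c i (\<lambda>y. f y - h y) x = pd c i f x - pd c i h x"
  using pd_add[OF assms(1) differentiable_in_minus[OF assms(2)], of i] pd_minus[OF assms(2), of i]
  by simp

lemma pd_sum:
  "(\<And>a. a \<in> I \<Longrightarrow> differentiable_in c (f a) x) \<Longrightarrow>
    pd c i (\<lambda>y. \<Sum>a\<in>I. f a y) x = (\<Sum>a\<in>I. pd c i (f a) x)"
  by (induction I rule: infinite_finite_induct)
    (auto simp: pd_const pd_add differentiable_in_sum)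

text \<open>Transformation laws hold on overlaps only; \<open>V\<close> will be the domain of the
  other chart.\<close>

lemma pd_cong_open:
  assumes "is_chart M c" "openin M V" "x \<in> dom_of c" "x \<in> V"
    and "\<And>y. y \<in> dom_of c \<Longrightarrow> y \<in> V \<Longrightarrow> f y = h y"
  shows "pd c i f x = pd c i h x"
  unfolding pd_def
  by (rule partial_cong[OF is_chart_open_image[OF assms(1,2)]])
    (use assms point_at_coord[OF assms(1)] in auto)

lemma pd_cong:
  assumes "is_chart M c" "x \<in> dom_of c" and "\<And>y. y \<in> dom_of c \<Longrightarrow> f y = h y"
  shows "pd c i f x = pd c i h x"
  by (rule pd_cong_open[OF assms(1) _ assms(2,2)]) (use assms in \<open>auto simp: is_chart_def\<close>)

lemma smooth_in_differentiable: "smooth_in c f \<Longrightarrow> x \<in> dom_of c \<Longrightarrow> differentiable_in c f x"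
  unfolding smooth_in_def differentiable_in_def by (rule smooth_on_differentiable) auto

lemma smooth_in_cong:
  assumes "is_chart M c" "\<And>y. y \<in> dom_of c \<Longrightarrow> f y = h y"
  shows "smooth_in c f \<longleftrightarrow> smooth_in c h"
  unfolding smooth_in_def
  by (rule smooth_on_cong[OF is_chart_open[OF assms(1)]])
    (use assms point_at_coord[OF assms(1)] in auto)

lemma smooth_in_const: "smooth_in c (\<lambda>y. r)"
  by (simp add: smooth_in_def smooth_on_const)

lemma smooth_in_add:
  "is_chart M c \<Longrightarrow> smooth_in c f \<Longrightarrow> smooth_in c h \<Longrightarrow> smooth_in c (\<lambda>y. f y + h y)"
  by (simp add: smooth_in_def smooth_on_add is_chart_open)

lemma smooth_in_mult:
  "is_chart M c \<Longrightarrow> smooth_in c f \<Longrightarrow> smooth_in c h \<Longrightarrow> smooth_in c (\<lambda>y. f y * h y)"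
  by (simp add: smooth_in_def smooth_on_mult is_chart_open)

lemma smooth_in_minus: "is_chart M c \<Longrightarrow> smooth_in c f \<Longrightarrow> smooth_in c (\<lambda>y. - f y)"
  using smooth_in_mult[of M c "\<lambda>_. -1" f] by (simp add: smooth_in_const)

lemma smooth_in_diff:
  "is_chart M c \<Longrightarrow> smooth_in c f \<Longrightarrow> smooth_in c h \<Longrightarrow> smooth_in c (\<lambda>y. f y - h y)"
  using smooth_in_add[of M c f "\<lambda>y. - h y"] by (simp add: smooth_in_minus)

lemma smooth_in_inverse:
  assumes "is_chart M c" "smooth_in c f" "\<And>x. x \<in> dom_of c \<Longrightarrow> f x \<noteq> 0"
  shows "smooth_in c (\<lambda>y. inverse (f y))"
  unfolding smooth_in_def
  by (rule smooth_on_inverse[OF is_chart_open[OF assms(1)]])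
    (use assms(2,3) point_at_coord[OF assms(1)] in \<open>auto simp: smooth_in_def\<close>)

lemma smooth_in_sum:
  "is_chart M c \<Longrightarrow> (\<And>a. a \<in> I \<Longrightarrow> smooth_in c (f a)) \<Longrightarrow> smooth_in c (\<lambda>y. \<Sum>a\<in>I. f a y)"
  by (induction I rule: infinite_finite_induct) (auto intro: smooth_in_const smooth_in_add)

lemma smooth_in_prod:
  "is_chart M c \<Longrightarrow> (\<And>a. a \<in> I \<Longrightarrow> smooth_in c (f a)) \<Longrightarrow> smooth_in c (\<lambda>y. \<Prod>a\<in>I. f a y)"
  by (induction I rule: infinite_finite_induct) (auto intro: smooth_in_const smooth_in_mult)

lemma smooth_in_pd:
  assumes "is_chart M c" "smooth_in c f"
  shows "smooth_in c (pd c i f)"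
proof -
  have "smooth_on (coord c ` dom_of c) (partial i (\<lambda>y. f (point_at c y)))"
    using assms(2) smooth_on_partial by (auto simp: smooth_in_def)
  then show ?thesis
    unfolding smooth_in_def
    by (rule smooth_on_cong[OF is_chart_open[OF assms(1)], THEN iffD1, rotated])
      (use point_at_coord[OF assms(1)] in \<open>auto simp: pd_def\<close>)
qed

text \<open>Serves transition maps, which are smooth only on an overlap; the second conclusion makes
  their first derivatives differentiable.\<close>

lemma pd_commute_local:
  assumes "is_chart M c" "openin M V" "x \<in> dom_of c" "x \<in> V"
    and "smooth_on (coord c ` (dom_of c \<inter> V)) (\<lambda>y. f (point_at c y))"
  shows "pd c i (pd c j f) x = pd c j (pd c i f) x"
    and "differentiable_in c (pd c i f) x"
proof -
  note o = is_chart_open_image[OF assms(1,2)]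
  have pp: "pd c l f (point_at c y) = partial l (\<lambda>y. f (point_at c y)) y"
    if "y \<in> coord c ` (dom_of c \<inter> V)" for l y
    using that point_at_coord[OF assms(1)] by (auto simp: pd_def)
  have xi: "coord c x \<in> coord c ` (dom_of c \<inter> V)" using assms(3,4) by auto
  have eq: "pd c k (pd c l f) x = partial k (partial l (\<lambda>y. f (point_at c y))) (coord c x)" for k l
    unfolding pd_def[of c k] by (rule partial_cong[OF o xi]) (rule pp)
  show "pd c i (pd c j f) x = pd c j (pd c i f) x"
    unfolding eq by (rule partial_commute[OF o xi assms(5)])
  show "differentiable_in c (pd c i f) x"
    unfolding differentiable_in_def
    by (subst differentiable_cong_open[OF o xi pp])
      (auto intro: smooth_on_differentiable[OF smooth_on_partial[OF assms(5)] xi])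
qed

lemma pd_commute:
  assumes "is_chart M c" "x \<in> dom_of c" "smooth_in c f"
  shows "pd c i (pd c j f) x = pd c j (pd c i f) x"
  by (rule pd_commute_local(1)[OF assms(1) _ assms(2,2)])
    (use assms in \<open>auto simp: is_chart_def smooth_in_def\<close>)

section \<open>Smoothness of the inverse of a matrix field\<close>

lemma matrix_inv_inverse:
  assumes "invertible A"
  shows matrix_inv_right: "A ** matrix_inv A = mat 1" and matrix_inv_left: "matrix_inv A ** A = mat 1"
  using someI_ex[OF assms[unfolded invertible_def]] by (simp_all add: matrix_inv_def)

text \<open>Cramer's rule for the right-hand side \<open>axis j 1\<close>. It presents the inverse
  through determinants, so that smoothness of the inverse metric reduces to that of
  \<open>det\<close>.\<close>

lemma matrix_inv_cramer:
  fixes A :: "real^'n^'n"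
  assumes "invertible A"
  shows "matrix_inv A $ i $ j
    = det (\<chi> k l. if l = i then (if k = j then 1 else 0) else A $ k $ l) * inverse (det A)"
proof -
  have "A *v (matrix_inv A *v axis j 1) = axis j 1"
    using assms by (simp add: matrix_vector_mul_assoc matrix_inv_right)
  then have "matrix_inv A *v axis j 1
      = (\<chi> k. det (\<chi> i l. if l = k then axis j 1 $ i else A $ i $ l) / det A)"
    using cramer[of A "matrix_inv A *v axis j 1" "axis j 1"] assms invertible_det_nz by blast
  then have "(matrix_inv A *v axis j 1) $ i = det (\<chi> k l. if l = i then axis j 1 $ k else A $ k $ l) / det A"
    by simp
  moreover have "(matrix_inv A *v axis j 1) $ i = matrix_inv A $ i $ j"
    by (simp add: matrix_vector_mult_basis column_def)
  moreover have "(\<lambda>k. axis j (1::real) $ k) = (\<lambda>k. if k = j then 1 else 0)"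
    by (auto simp: axis_def)
  ultimately show ?thesis
    by (simp add: divide_inverse cong: if_cong)
qed

lemma smooth_in_det:
  assumes "is_chart M c" "\<And>i j. smooth_in c (\<lambda>x. A x $ i $ j)"
  shows "smooth_in c (\<lambda>x. det (A x :: real^'k::finite^'k))"
  unfolding det_def
  by (intro smooth_in_sum[OF assms(1)] smooth_in_mult[OF assms(1)] smooth_in_prod[OF assms(1)]
      smooth_in_const assms)

section \<open>Symmetries and Bianchi identities of the curvature tensor\<close>

locale metric_chart =
  fixes M :: "'m topology" and c :: "('m, 'n::finite) chart" and g :: "('m, 'n) tensor2"
  assumes chart: "is_chart M c"
    and g_smooth: "\<And>i j. smooth_in c (\<lambda>x. g c x i j)"
    and g_sym: "\<And>x i j. x \<in> dom_of c \<Longrightarrow> g c x i j = g c x j i"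
    and g_invertible: "\<And>x. x \<in> dom_of c \<Longrightarrow> invertible (metric_matrix g c x)"
begin

abbreviation "\<Gamma> \<equiv> christoffel g c"
abbreviation "Rm \<equiv> riemann g c"

text \<open>Christoffel symbols of the first kind, with the lowered index in the first slot. Being
  free of the inverse metric, they simplify the curvature formula and the change of charts.\<close>

definition christoffel_low :: "'m \<Rightarrow> 'n \<Rightarrow> 'n \<Rightarrow> 'n \<Rightarrow> real" where
  "christoffel_low x l i j =
     1/2 * (pd c i (\<lambda>y. g c y j l) x + pd c j (\<lambda>y. g c y i l) x - pd c l (\<lambda>y. g c y i j) x)"

lemma metric_mult_inv:
  assumes "x \<in> dom_of c"
  shows "(\<Sum>j\<in>UNIV. g c x i j * inv_metric g c x j k) = (if i = k then 1 else 0)"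
  using matrix_inv_right[OF g_invertible[OF assms]]
  by (simp add: vec_eq_iff matrix_matrix_mult_def mat_def metric_matrix_def inv_metric_def)

lemma inv_metric_mult:
  assumes "x \<in> dom_of c"
  shows "(\<Sum>j\<in>UNIV. inv_metric g c x i j * g c x j k) = (if i = k then 1 else 0)"
  using matrix_inv_left[OF g_invertible[OF assms]]
  by (simp add: vec_eq_iff matrix_matrix_mult_def mat_def metric_matrix_def inv_metric_def)

lemma lower_raise:
  assumes "x \<in> dom_of c"
  shows "(\<Sum>a\<in>UNIV. g c x l a * (\<Sum>m\<in>UNIV. inv_metric g c x a m * f m)) = f l"
proof -
  have "(\<Sum>a\<in>UNIV. g c x l a * (\<Sum>m\<in>UNIV. inv_metric g c x a m * f m))
      = (\<Sum>m\<in>UNIV. (\<Sum>a\<in>UNIV. g c x l a * inv_metric g c x a m) * f m)"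
    unfolding sum_distrib_left sum_distrib_right by (subst sum.swap) (simp add: mult.assoc)
  then show ?thesis by (simp add: metric_mult_inv[OF assms] if_distrib[of "\<lambda>z. z * _"] cong: if_cong)
qed

lemma inv_metric_sym:
  assumes "x \<in> dom_of c"
  shows "inv_metric g c x i j = inv_metric g c x j i"
proof -
  let ?h = "inv_metric g c x"
  have "?h i j = (\<Sum>a\<in>UNIV. (\<Sum>b\<in>UNIV. g c x a b * ?h b i) * ?h a j)"
    by (simp add: metric_mult_inv[OF assms] if_distrib[of "\<lambda>z. z * _"] cong: if_cong)
  also have "\<dots> = (\<Sum>b\<in>UNIV. ?h b i * (\<Sum>a\<in>UNIV. g c x b a * ?h a j))"
    unfolding sum_distrib_left sum_distrib_right
    by (subst sum.swap) (simp add: g_sym[OF assms] mult_ac)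
  also have "\<dots> = ?h j i"
    by (simp add: metric_mult_inv[OF assms] if_distrib[of "\<lambda>z. _ * z"] cong: if_cong)
  finally show ?thesis .
qed

lemma metric_christoffel:
  assumes "x \<in> dom_of c"
  shows "(\<Sum>a\<in>UNIV. g c x l a * \<Gamma> x a i j) = christoffel_low x l i j"
  unfolding christoffel_def christoffel_low_def sum_distrib_left
  using lower_raise[OF assms, of l "\<lambda>l. 1/2 * (pd c i (\<lambda>y. g c y j l) x + pd c j (\<lambda>y. g c y i l) x - pd c l (\<lambda>y. g c y i j) x)"]
  by (simp add: sum_distrib_left mult_ac)

lemma pd_metric_sym:
  "x \<in> dom_of c \<Longrightarrow> pd c k (\<lambda>y. g c y i j) x = pd c k (\<lambda>y. g c y j i) x"
  by (rule pd_cong[OF chart]) (auto intro: g_sym)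

lemma christoffel_low_sym: "x \<in> dom_of c \<Longrightarrow> christoffel_low x l i j = christoffel_low x l j i"
  unfolding christoffel_low_def using pd_metric_sym[of x l i j] by simp

lemma christoffel_sym: "x \<in> dom_of c \<Longrightarrow> \<Gamma> x k i j = \<Gamma> x k j i"
  unfolding christoffel_def using pd_metric_sym[of x _ i j] by (simp add: add.commute)

text \<open>Metric compatibility of the Levi-Civita connection: in the sum of the two symbols all
  other derivatives of \<open>g\<close> cancel.\<close>

lemma pd_metric:
  assumes "x \<in> dom_of c"
  shows "pd c k (\<lambda>y. g c y i j) x = christoffel_low x i k j + christoffel_low x j k i"
  unfolding christoffel_low_def using pd_metric_sym[OF assms, of _ j i] pd_metric_sym[OF assms, of _ k i]
    pd_metric_sym[OF assms, of _ k j]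
  by (simp add: field_simps)

section \<open>Smoothness of the connection and the curvature\<close>

lemma inv_metric_smooth: "smooth_in c (\<lambda>x. inv_metric g c x i j)"
proof -
  have d: "smooth_in c (\<lambda>x. inverse (det (metric_matrix g c x)))"
    by (intro smooth_in_inverse[OF chart] smooth_in_det[OF chart])
      (use g_invertible invertible_det_nz in \<open>auto simp: metric_matrix_def g_smooth\<close>)
  have e: "smooth_in c (\<lambda>x. det (\<chi> k l. if l = i then (if k = j then 1 else 0) else metric_matrix g c x $ k $ l))"
  proof (rule smooth_in_det[OF chart])
    fix k l
    show "smooth_in c (\<lambda>x. (\<chi> k l. if l = i then (if k = j then 1 else 0) else metric_matrix g c x $ k $ l) $ k $ l)"
      by (cases "l = i") (simp_all add: metric_matrix_def g_smooth smooth_in_const)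
  qed
  show ?thesis
    by (rule smooth_in_cong[OF chart, THEN iffD1, rotated, OF smooth_in_mult[OF chart e d]])
      (simp add: inv_metric_def matrix_inv_cramer g_invertible)
qed

lemma christoffel_smooth: "smooth_in c (\<lambda>x. \<Gamma> x k i j)"
  unfolding christoffel_def
  by (intro smooth_in_mult[OF chart] smooth_in_const smooth_in_sum[OF chart] smooth_in_diff[OF chart]
      smooth_in_add[OF chart] inv_metric_smooth smooth_in_pd[OF chart] g_smooth)

lemma christoffel_low_smooth: "smooth_in c (\<lambda>x. christoffel_low x l i j)"
  unfolding christoffel_low_def
  by (intro smooth_in_mult[OF chart] smooth_in_const smooth_in_diff[OF chart]
      smooth_in_add[OF chart] smooth_in_pd[OF chart] g_smooth)

lemma riemann_up_smooth: "smooth_in c (\<lambda>x. riemann_up g c x a b k l)"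
  unfolding riemann_up_def
  by (intro smooth_in_mult[OF chart] smooth_in_sum[OF chart] smooth_in_diff[OF chart]
      smooth_in_add[OF chart] smooth_in_pd[OF chart] christoffel_smooth)

lemma riemann_smooth: "smooth_in c (\<lambda>x. Rm x j k l m)"
  unfolding riemann_def
  by (intro smooth_in_mult[OF chart] smooth_in_sum[OF chart] riemann_up_smooth g_smooth)

lemmas smooth_diff = smooth_in_differentiable[OF g_smooth] smooth_in_differentiable[OF christoffel_smooth]
  smooth_in_differentiable[OF christoffel_low_smooth] smooth_in_differentiable[OF riemann_up_smooth]
  smooth_in_differentiable[OF riemann_smooth]

text \<open>Moving \<open>g\<close> past the derivative costs the derivative of \<open>g\<close>,
  which metric compatibility splits into two symbols. The first resulting sum will cancel a product
  term of the curvature.\<close>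

lemma metric_pd_christoffel:
  assumes "x \<in> dom_of c"
  shows "(\<Sum>a\<in>UNIV. g c x j a * pd c l (\<lambda>y. \<Gamma> y a m k) x)
    = pd c l (\<lambda>y. christoffel_low y j m k) x
      - (\<Sum>a\<in>UNIV. christoffel_low x j l a * \<Gamma> x a m k) - (\<Sum>a\<in>UNIV. christoffel_low x a l j * \<Gamma> x a m k)"
proof -
  have "pd c l (\<lambda>y. christoffel_low y j m k) x = pd c l (\<lambda>y. \<Sum>a\<in>UNIV. g c y j a * \<Gamma> y a m k) x"
    by (rule pd_cong[OF chart assms]) (simp add: metric_christoffel)
  also have "\<dots> = (\<Sum>a\<in>UNIV. g c x j a * pd c l (\<lambda>y. \<Gamma> y a m k) x
      + pd c l (\<lambda>y. g c y j a) x * \<Gamma> x a m k)"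
    using assms by (simp add: pd_sum pd_mult[OF chart] differentiable_in_intros smooth_diff)
  finally show ?thesis
    by (simp add: pd_metric[OF assms] sum.distrib distrib_right)
qed

text \<open>The \<open>g\<close>-inner product of two columns of Christoffel symbols, the form that
  the quadratic terms of the lowered curvature take.\<close>

definition christoffel_quad :: "'m \<Rightarrow> 'n \<Rightarrow> 'n \<Rightarrow> 'n \<Rightarrow> 'n \<Rightarrow> real" where
  "christoffel_quad x i j k l = (\<Sum>a\<in>UNIV. \<Sum>b\<in>UNIV. g c x a b * \<Gamma> x a i j * \<Gamma> x b k l)"

lemma christoffel_quad_sym:
  assumes "x \<in> dom_of c"
  shows "christoffel_quad x k l i j = christoffel_quad x i j k l"
    and "christoffel_quad x i j l k = christoffel_quad x i j k l"
proof -
  show "christoffel_quad x k l i j = christoffel_quad x i j k l"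
    unfolding christoffel_quad_def
    by (subst sum.swap) (simp add: g_sym[OF assms] mult_ac)
  show "christoffel_quad x i j l k = christoffel_quad x i j k l"
    unfolding christoffel_quad_def using christoffel_sym[OF assms, of _ l k] by simp
qed

lemma christoffel_quad_eq:
  assumes "x \<in> dom_of c"
  shows "(\<Sum>a\<in>UNIV. christoffel_low x a i j * \<Gamma> x a k l) = christoffel_quad x i j k l"
  unfolding christoffel_quad_def metric_christoffel[OF assms, symmetric] sum_distrib_right
  by (subst sum.swap) (simp add: g_sym[OF assms])

text \<open>The product terms of \<open>riemann_up\<close> cancel against half of those from
  \<open>metric_pd_christoffel\<close>, leaving a form in which the index symmetries can be read
  off.\<close>

lemma riemann_eq:
  assumes "x \<in> dom_of c"
  shows "Rm x j k l m = pd c l (\<lambda>y. christoffel_low y j m k) x - pd c m (\<lambda>y. christoffel_low y j l k) x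
    - christoffel_quad x l j m k + christoffel_quad x m j l k"
proof -
  have B: "(\<Sum>a\<in>UNIV. g c x j a * (\<Sum>e\<in>UNIV. \<Gamma> x a l e * \<Gamma> x e m k))
      = (\<Sum>e\<in>UNIV. christoffel_low x j l e * \<Gamma> x e m k)" for l m
    unfolding metric_christoffel[OF assms, symmetric] sum_distrib_right sum_distrib_left
    by (subst sum.swap) (simp add: mult.assoc)
  have "Rm x j k l m = (\<Sum>a\<in>UNIV. g c x j a * pd c l (\<lambda>y. \<Gamma> y a m k) x)
     - (\<Sum>a\<in>UNIV. g c x j a * pd c m (\<lambda>y. \<Gamma> y a l k) x)
     + (\<Sum>a\<in>UNIV. g c x j a * (\<Sum>e\<in>UNIV. \<Gamma> x a l e * \<Gamma> x e m k))
     - (\<Sum>a\<in>UNIV. g c x j a * (\<Sum>e\<in>UNIV. \<Gamma> x a m e * \<Gamma> x e l k))"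
    unfolding riemann_def riemann_up_def
    by (simp add: algebra_simps sum.distrib sum_subtractf)
  then show ?thesis
    unfolding B metric_pd_christoffel[OF assms] christoffel_quad_eq[OF assms] by simp
qed

lemma pd_christoffel_low:
  assumes "x \<in> dom_of c"
  shows "pd c l (\<lambda>y. christoffel_low y j m k) x =
    1/2 * (pd c l (pd c m (\<lambda>y. g c y k j)) x + pd c l (pd c k (\<lambda>y. g c y m j)) x
      - pd c l (pd c j (\<lambda>y. g c y m k)) x)"
  unfolding christoffel_low_def
  using smooth_in_differentiable[OF smooth_in_pd[OF chart g_smooth] assms]
  by (subst pd_cmult) (simp_all add: pd_add pd_diff differentiable_in_add differentiable_in_diff)

lemma riemann_antisym_right: "Rm x j k l m = - Rm x j k m l"
  unfolding riemann_def riemann_up_def by (simp add: sum_negf[symmetric] algebra_simps)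

text \<open>Second derivatives of \<open>g\<close> cancel once mixed derivatives are commuted and
  \<open>g\<close> is transposed; the quadratic terms cancel by the symmetries of
  \<open>christoffel_quad\<close>.\<close>

lemma riemann_antisym_left:
  assumes "x \<in> dom_of c"
  shows "Rm x j k l m = - Rm x k j l m"
proof -
  have s: "pd c a (pd c b (\<lambda>y. g c y i j)) x = pd c a (pd c b (\<lambda>y. g c y j i)) x" for a b i j
    by (rule pd_cong[OF chart assms]) (rule pd_metric_sym)
  show ?thesis
    unfolding riemann_eq[OF assms] pd_christoffel_low[OF assms]
    using pd_commute[OF chart assms g_smooth, of l m j k] pd_commute[OF chart assms g_smooth, of l m k j]
      christoffel_quad_sym[OF assms, of m k l j] christoffel_quad_sym[OF assms, of l k m j]
      s[of l m k j] s[of m l k j] s[of l k j m] s[of l j k m] s[of m k j l] s[of m j k l]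
    by (simp add: algebra_simps)
qed

text \<open>Every term occurs twice with opposite signs after the lower indices of the Christoffel
  symbols are put in a common order.\<close>

lemma first_bianchi:
  assumes "x \<in> dom_of c"
  shows "Rm x j k l m + Rm x j l m k + Rm x j m k l = 0"
proof -
  have s: "pd c a (\<lambda>y. christoffel_low y i j k) x = pd c a (\<lambda>y. christoffel_low y i k j) x" for a i j k
    by (rule pd_cong[OF chart assms]) (rule christoffel_low_sym)
  show ?thesis
    unfolding riemann_eq[OF assms] s[of k j m l] s[of l j m k] s[of m j l k]
      christoffel_quad_sym(2)[OF assms, of _ j m k] christoffel_quad_sym(2)[OF assms, of _ j m l]
      christoffel_quad_sym(2)[OF assms, of _ j l k]
    by simp
qed


section \<open>The second Bianchi identity\<close>

definition christoffel_matrix :: "'m \<Rightarrow> 'n \<Rightarrow> real^'n^'n" where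
  "christoffel_matrix x l = (\<chi> a b. \<Gamma> x a l b)"

text \<open>With \<open>a\<close> raised, \<open>a\<close> and \<open>k\<close> are row and column
  of the curvature endomorphism, so that matrix algebra applies.\<close>

definition cov_riemann_up :: "'m \<Rightarrow> 'n \<Rightarrow> 'n \<Rightarrow> 'n \<Rightarrow> 'n \<Rightarrow> 'n \<Rightarrow> real" where
  "cov_riemann_up x i a k l m = pd c i (\<lambda>y. riemann_up g c y a k l m) x
     + (\<Sum>e\<in>UNIV. \<Gamma> x a i e * riemann_up g c x e k l m)
     - (\<Sum>e\<in>UNIV. \<Gamma> x e i k * riemann_up g c x a e l m)
     - (\<Sum>e\<in>UNIV. \<Gamma> x e i l * riemann_up g c x a k e m)
     - (\<Sum>e\<in>UNIV. \<Gamma> x e i m * riemann_up g c x a k l e)"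

text \<open>Lowering commutes with the covariant derivative because \<open>g\<close> is parallel: of
  the two symbols in the derivative of \<open>g\<close>, one cancels the correction for the lower
  index \<open>j\<close>, the other becomes the correction for the upper index
  \<open>a\<close>.\<close>

lemma cov_deriv4_riemann:
  assumes "x \<in> dom_of c"
  shows "cov_deriv4 g c Rm x i j k l m = (\<Sum>a\<in>UNIV. g c x j a * cov_riemann_up x i a k l m)"
proof -
  let ?R = "riemann_up g c x"
  have "pd c i (\<lambda>y. Rm y j k l m) x = (\<Sum>a\<in>UNIV. g c x j a * pd c i (\<lambda>y. riemann_up g c y a k l m) x
      + (christoffel_low x j i a + christoffel_low x a i j) * ?R a k l m)"
    unfolding riemann_def using assms
    by (simp add: pd_sum pd_mult[OF chart] differentiable_in_intros smooth_diff pd_metric)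
  moreover have "(\<Sum>a\<in>UNIV. christoffel_low x a i j * ?R a k l m) = (\<Sum>a\<in>UNIV. \<Gamma> x a i j * Rm x a k l m)"
    unfolding riemann_def metric_christoffel[OF assms, symmetric] sum_distrib_left sum_distrib_right
    by (subst sum.swap) (simp add: g_sym[OF assms] mult_ac)
  moreover have "(\<Sum>a\<in>UNIV. christoffel_low x j i a * ?R a k l m)
      = (\<Sum>a\<in>UNIV. g c x j a * (\<Sum>e\<in>UNIV. \<Gamma> x a i e * ?R e k l m))"
    unfolding metric_christoffel[OF assms, symmetric] sum_distrib_left sum_distrib_right
    by (subst sum.swap) (simp add: mult_ac)
  moreover have "(\<Sum>e\<in>UNIV. \<Gamma> x e i k * Rm x j e l m) = (\<Sum>a\<in>UNIV. g c x j a * (\<Sum>e\<in>UNIV. \<Gamma> x e i k * ?R a e l m))"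
    unfolding riemann_def sum_distrib_left sum_distrib_right
    by (subst sum.swap) (simp add: mult_ac)
  moreover have "(\<Sum>e\<in>UNIV. \<Gamma> x e i l * Rm x j k e m) = (\<Sum>a\<in>UNIV. g c x j a * (\<Sum>e\<in>UNIV. \<Gamma> x e i l * ?R a k e m))"
    unfolding riemann_def sum_distrib_left sum_distrib_right
    by (subst sum.swap) (simp add: mult_ac)
  moreover have "(\<Sum>e\<in>UNIV. \<Gamma> x e i m * Rm x j k l e) = (\<Sum>a\<in>UNIV. g c x j a * (\<Sum>e\<in>UNIV. \<Gamma> x e i m * ?R a k l e))"
    unfolding riemann_def sum_distrib_left sum_distrib_right
    by (subst sum.swap) (simp add: mult_ac)
  ultimately show ?thesis
    unfolding cov_deriv4_def cov_riemann_up_def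
    by (simp add: distrib_left distrib_right right_diff_distrib sum.distrib sum_subtractf)
qed

end

lemma matrix_add_rdistrib: "(B + C) ** A = B ** A + (C :: real^'n^'m) ** A"
  by (simp add: matrix_matrix_mult_def vec_eq_iff distrib_right sum.distrib)

lemma matrix_diff_ldistrib: "A ** (B - C) = A ** B - A ** (C :: real^'n^'m)"
  by (simp add: matrix_matrix_mult_def vec_eq_iff right_diff_distrib sum_subtractf)

lemma matrix_diff_rdistrib: "(B - C) ** A = B ** A - (C :: real^'n^'m) ** A"
  by (simp add: matrix_matrix_mult_def vec_eq_iff left_diff_distrib sum_subtractf)

text \<open>With \<open>D\<close> and \<open>DD\<close> in the role of the first and second derivatives of the connection
  matrices \<open>G\<close>, this is the second Bianchi identity, which reduces to the Jacobi identity for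
  commutators of matrices.\<close>

lemma matrix_bianchi:
  fixes G :: "'n \<Rightarrow> real^'n::finite^'n" and D :: "'n \<Rightarrow> 'n \<Rightarrow> real^'n^'n"
    and DD :: "'n \<Rightarrow> 'n \<Rightarrow> 'n \<Rightarrow> real^'n^'n"
  assumes DD: "\<And>i j l. DD i j l = DD j i l"
    and R: "\<And>l m. R l m = D l m - D m l + G l ** G m - G m ** G l"
    and dR: "\<And>i l m. dR i l m = DD i l m - DD i m l + (D i l ** G m + G l ** D i m)
      - (D i m ** G l + G m ** D i l)"
    and P: "\<And>i l m. P i l m = dR i l m + G i ** R l m - R l m ** G i"
  shows "P i l m + P l m i + P m i l = 0"
  unfolding P R dR DD[of m l] DD[of i m] DD[of l i]
  by (simp add: matrix_add_ldistrib matrix_add_rdistrib matrix_diff_ldistrib matrix_diff_rdistrib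
      matrix_mul_assoc algebra_simps)

context metric_chart begin

text \<open>\<open>matrix_bianchi\<close> gives the cyclic sum without the corrections for the form
  indices \<open>l\<close> and \<open>m\<close>. Those cancel in pairs, since
  \<open>\<Gamma>\<close> is symmetric and the curvature antisymmetric there.\<close>

lemma cov_riemann_up_cyclic:
  assumes x: "x \<in> dom_of c"
  shows "cov_riemann_up x i a k l m + cov_riemann_up x l a k m i + cov_riemann_up x m a k i l = 0"
proof -
  let ?R = "riemann_up g c x"
  define D where "D i l = (\<chi> a b. pd c i (\<lambda>y. \<Gamma> y a l b) x)" for i l
  define DD where "DD i j l = (\<chi> a b. pd c i (pd c j (\<lambda>y. \<Gamma> y a l b)) x)" for i j l
  define R where "R l m = D l m - D m l + christoffel_matrix x l ** christoffel_matrix x m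
      - christoffel_matrix x m ** christoffel_matrix x l" for l m
  define dR where "dR i l m = DD i l m - DD i m l
      + (D i l ** christoffel_matrix x m + christoffel_matrix x l ** D i m)
      - (D i m ** christoffel_matrix x l + christoffel_matrix x m ** D i l)" for i l m
  define P where "P i l m = dR i l m + christoffel_matrix x i ** R l m - R l m ** christoffel_matrix x i" for i l m
  have DDs: "DD i j l = DD j i l" for i j l
    unfolding DD_def using pd_commute[OF chart x christoffel_smooth] by (simp add: vec_eq_iff)
  have cyc: "P i l m + P l m i + P m i l = 0"
    by (rule matrix_bianchi[OF DDs R_def dR_def P_def])
  have R: "R l m $ a $ k = ?R a k l m" for l m a k
    by (simp add: R_def D_def christoffel_matrix_def riemann_up_def matrix_matrix_mult_def)
  have d: "differentiable_in c (\<lambda>y. \<Gamma> y a l b) x" "differentiable_in c (pd c i (\<lambda>y. \<Gamma> y a l b)) x" for a l b i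
    using smooth_in_differentiable[OF _ x] christoffel_smooth smooth_in_pd[OF chart] by blast+
  have dR: "dR i l m $ a $ k = pd c i (\<lambda>y. riemann_up g c y a k l m) x" for i l m a k
    unfolding riemann_up_def
    using d
    by (simp add: dR_def D_def DD_def christoffel_matrix_def matrix_matrix_mult_def pd_add pd_diff
        pd_sum pd_mult[OF chart x] differentiable_in_intros sum.distrib mult.commute)
  have P: "P i l m $ a $ k = cov_riemann_up x i a k l m + (\<Sum>e\<in>UNIV. \<Gamma> x e i l * ?R a k e m)
     + (\<Sum>e\<in>UNIV. \<Gamma> x e i m * ?R a k l e)" for i l m
    unfolding P_def cov_riemann_up_def
    by (simp add: dR matrix_matrix_mult_def R christoffel_matrix_def mult.commute)
  have anti: "(\<Sum>e\<in>UNIV. \<Gamma> x e i l * ?R a k e m) = - (\<Sum>e\<in>UNIV. \<Gamma> x e l i * ?R a k m e)" for i l m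
    unfolding sum_negf[symmetric] using christoffel_sym[OF x, of _ l i]
    by (intro sum.cong) (auto simp: riemann_up_def algebra_simps)
  show ?thesis
    using arg_cong[OF cyc, of "\<lambda>A. A $ a $ k"] anti[of i l m] anti[of l m i] anti[of m i l]
    by (simp add: P)
qed

lemma second_bianchi:
  assumes "x \<in> dom_of c"
  shows "cov_deriv4 g c Rm x i j k l m + cov_deriv4 g c Rm x l j k m i + cov_deriv4 g c Rm x m j k i l = 0"
  unfolding cov_deriv4_riemann[OF assms] sum.distrib[symmetric] distrib_left[symmetric]
  by (simp add: cov_riemann_up_cyclic[OF assms])

end

section \<open>Contraction with vectors, and umbilic forms on a hyperplane\<close>

text \<open>Contraction of one index; taking a function of that index lets any slot of a tensor be
  contracted through a lambda abstraction.\<close>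

definition ctr :: "real^'n::finite \<Rightarrow> ('n \<Rightarrow> real) \<Rightarrow> real" where
  "ctr v f = (\<Sum>i\<in>UNIV. v $ i * f i)"

definition bil :: "('n::finite \<Rightarrow> 'n \<Rightarrow> real) \<Rightarrow> real^'n \<Rightarrow> real^'n \<Rightarrow> real" where
  "bil t v w = ctr v (\<lambda>i. ctr w (t i))"

lemma ctr_linear:
  "ctr v (\<lambda>i. f i + h i) = ctr v f + ctr v h"
  "ctr v (\<lambda>i. f i - h i) = ctr v f - ctr v h"
  "ctr v (\<lambda>i. - f i) = - ctr v f"
  "ctr v (\<lambda>i. r * f i) = r * ctr v f"
  "ctr v (\<lambda>i. f i * r) = ctr v f * r"
  "ctr v (\<lambda>i. 0) = 0"
  "ctr v (\<lambda>i. f i / r) = ctr v f / r"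
  unfolding ctr_def
  by (simp_all add: algebra_simps sum.distrib sum_subtractf sum_negf sum_distrib_left sum_divide_distrib)

lemma ctr_linear_left:
  "ctr (v + w) f = ctr v f + ctr w f"
  "ctr (v - w) f = ctr v f - ctr w f"
  "ctr (r *\<^sub>R v) f = r * ctr v f"
  "ctr 0 f = 0"
  unfolding ctr_def
  by (simp_all add: algebra_simps sum.distrib sum_subtractf sum_distrib_left)

lemma ctr_inner: "ctr v f = v \<bullet> (\<chi> i. f i)"
  by (simp add: ctr_def inner_vec_def)

lemma ctr_axis: "ctr (axis i 1) f = f i"
  unfolding ctr_def axis_def by (simp add: if_distrib[of "\<lambda>z. z * _"] cong: if_cong)

lemma ctr_swap: "ctr v (\<lambda>i. ctr w (\<lambda>j. t i j)) = ctr w (\<lambda>j. ctr v (\<lambda>i. t i j))"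
  unfolding ctr_def sum_distrib_left by (subst sum.swap) (simp add: mult_ac)

lemma ctr_rotate:
  "ctr u (\<lambda>a. ctr v (\<lambda>b. ctr w (t a b))) = ctr w (\<lambda>d. ctr u (\<lambda>a. ctr v (\<lambda>b. t a b d)))"
proof -
  have "(\<lambda>a. ctr v (\<lambda>b. ctr w (t a b))) = (\<lambda>a. ctr w (\<lambda>d. ctr v (\<lambda>b. t a b d)))"
    by (rule ext) (rule ctr_swap)
  then show ?thesis by (simp only: ctr_swap[of u w])
qed

lemma bil_linear:
  "bil t (v + w) z = bil t v z + bil t w z"
  "bil t (v - w) z = bil t v z - bil t w z"
  "bil t (r *\<^sub>R v) z = r * bil t v z"
  "bil t z (v + w) = bil t z v + bil t z w"
  "bil t z (v - w) = bil t z v - bil t z w"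
  "bil t z (r *\<^sub>R v) = r * bil t z v"
  by (simp_all add: bil_def ctr_linear_left ctr_linear)

lemma bil_axis: "bil t (axis i 1) (axis j 1) = t i j"
  by (simp add: bil_def ctr_axis)

lemma bil_commute:
  assumes "\<And>i j. t i j = t j i"
  shows "bil t v w = bil t w v"
proof -
  have "(\<lambda>i. t i j) = t j" for j
    by (rule ext) (rule assms)
  then show ?thesis
    unfolding bil_def by (subst ctr_swap) simp
qed

lemma exists_orthogonal_to_three:
  fixes p q r :: "real^'n::finite"
  assumes "CARD('n) > 3"
  shows "\<exists>x. x \<noteq> 0 \<and> x \<bullet> p = 0 \<and> x \<bullet> q = 0 \<and> x \<bullet> r = 0"
proof -
  have "dim {p, q, r} \<le> card {p, q, r}" by (rule dim_le_card) (auto intro: span_base)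
  also have "\<dots> \<le> 3" by (auto simp: card_insert_if)
  finally have "dim {p, q, r} < DIM(real^'n)" using assms by simp
  from orthogonal_to_subspace_exists[OF this] obtain x where
    "x \<noteq> 0" "\<And>y. y \<in> span {p, q, r} \<Longrightarrow> orthogonal x y" by auto
  then show ?thesis using span_base[of _ "{p, q, r}"] unfolding orthogonal_def by blast
qed

text \<open>Usually \<open>p\<close> cuts out the hyperplane of \<open>A\<close> and the other slots
  impose orthogonality conditions; repeating an entry stands for fewer conditions.\<close>

lemma exists_common_kernel:
  fixes p q r :: "'n::finite \<Rightarrow> real"
  assumes "CARD('n) > 3"
  shows "\<exists>x. x \<noteq> 0 \<and> ctr x p = 0 \<and> ctr x q = 0 \<and> ctr x r = 0"
  using exists_orthogonal_to_three[OF assms, of "\<chi> i. p i" "\<chi> i. q i" "\<chi> i. r i"]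
  by (simp add: ctr_inner)

text \<open>For fixed \<open>U\<close> and \<open>Z\<close> the last hypothesis says that the bivectors \<open>B U \<and> Q Z\<close> and
  \<open>U \<and> Z\<close> are proportional. As the hyperplane \<open>ctr _ A = 0\<close> has dimension at least three, this
  forces \<open>B\<close> and \<open>Q\<close> to be multiples of \<open>g\<close> there.\<close>

lemma wedge_identity_umbilic:
  fixes g B Q :: "'n::finite \<Rightarrow> 'n \<Rightarrow> real" and V :: "real^'n"
  assumes dim: "CARD('n) > 3" and \<gamma>: "\<gamma> \<noteq> 0"
    and gs: "\<And>i j. g i j = g j i" and Qs: "\<And>i j. Q i j = Q j i"
    and nondeg: "\<And>X. (\<And>Y. bil g X Y = 0) \<Longrightarrow> X = 0"
    and V: "\<And>X. bil g V X = ctr X A" and VA: "ctr V A \<noteq> 0"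
    and star: "\<And>U X Y Z. ctr X A = 0 \<Longrightarrow> ctr Y A = 0 \<Longrightarrow> ctr Z A = 0 \<Longrightarrow>
      bil B U X * bil Q Y Z - bil B U Y * bil Q X Z = \<gamma> * (bil g U X * bil g Y Z - bil g U Y * bil g X Z)"
  obtains l where "l \<noteq> 0" "\<And>X Y. ctr X A = 0 \<Longrightarrow> ctr Y A = 0 \<Longrightarrow> bil Q X Y = l * bil g X Y"
    "\<And>U X. ctr X A = 0 \<Longrightarrow> l * bil B U X = \<gamma> * bil g U X"
proof -
  note gc = bil_commute[of g, OF gs] and Qc = bil_commute[of Q, OF Qs]
  \<comment> \<open>\<open>g\<close> stays nondegenerate on the hyperplane: \<open>V\<close> is
    orthogonal to it and not contained in it, so the part of a test vector along \<open>V\<close>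
    can be subtracted.\<close>
  have nd: "\<exists>W. ctr W A = 0 \<and> bil g W Z \<noteq> 0" if Z: "ctr Z A = 0" "Z \<noteq> 0" for Z
  proof -
    obtain Y where Y: "bil g Z Y \<noteq> 0" using nondeg Z by blast
    let ?W = "Y - (ctr Y A / ctr V A) *\<^sub>R V"
    have "ctr ?W A = 0" using VA by (simp add: ctr_linear_left)
    moreover have "bil g V Z = 0" using V Z by simp
    then have "bil g ?W Z \<noteq> 0" using Y gc[of Y Z] by (simp add: bil_linear)
    ultimately show ?thesis by blast
  qed
  have perp: "\<exists>Z. Z \<noteq> 0 \<and> ctr Z A = 0 \<and> bil g Z X = 0" for X
    using exists_common_kernel[OF dim, of A "\<lambda>i. ctr X (g i)" A] by (auto simp: bil_def)
  \<comment> \<open>Otherwise some nonzero \<open>U\<close> in the hyperplane has \<open>B U\<close>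
    vanishing on it, and then the right-hand side of \<open>star\<close> vanishes too, against the
    nondegeneracy of \<open>g\<close> there.\<close>
  have s1: "bil Q Y Z = 0" if Y: "ctr Y A = 0" and Z: "ctr Z A = 0" and YZ: "bil g Y Z = 0" for Y Z
  proof (rule ccontr)
    assume n: "bil Q Y Z \<noteq> 0"
    \<comment> \<open>This choice leaves only \<open>bil B U X * bil Q Y Z\<close> in
      \<open>star\<close>.\<close>
    obtain U where U: "U \<noteq> 0" "ctr U A = 0" "bil g U Y = 0" "bil B U Y = 0"
      using exists_common_kernel[OF dim, of A "\<lambda>i. ctr Y (g i)" "\<lambda>i. ctr Y (B i)"] by (auto simp: bil_def)
    have BU: "bil B U X = 0" if X: "ctr X A = 0" for X
      using star[OF X Y Z, of U] U YZ n by simp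
    obtain W where W: "ctr W A = 0" "bil g W U \<noteq> 0" using nd[OF U(2,1)] by blast
    obtain Z' where Z': "Z' \<noteq> 0" "ctr Z' A = 0" "bil g Z' W = 0" using perp by blast
    obtain Y' where Y': "ctr Y' A = 0" "bil g Y' Z' \<noteq> 0" using nd[OF Z'(2,1)] by blast
    have "\<gamma> * (bil g U W * bil g Y' Z' - bil g U Y' * bil g W Z') = 0"
      using star[OF W(1) Y'(1) Z'(2), of U] BU[OF W(1)] BU[OF Y'(1)] by simp
    moreover have "bil g U W \<noteq> 0" using W(2) gc[of U W] by simp
    moreover have "bil g W Z' = 0" using Z'(3) gc[of W Z'] by simp
    ultimately show False using \<gamma> Y'(2) by simp
  qed
  obtain P where P: "P \<noteq> 0" "ctr P A = 0" using perp by blast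
  obtain R where R: "ctr R A = 0" "bil g R P \<noteq> 0" using nd[OF P(2,1)] by blast
  define l where "l = bil Q R P / bil g R P"
  \<comment> \<open>The combination \<open>bil g Y2 Z *\<^sub>R Y1 - bil g Y1 Z *\<^sub>R Y2\<close>
    is \<open>g\<close>-orthogonal to \<open>Z\<close>, so \<open>s1\<close> makes
    \<open>bil Q _ Z\<close> and \<open>bil g _ Z\<close> proportional on the hyperplane. The pair
    \<open>R\<close>, \<open>P\<close> fixes the common factor.\<close>
  have prp: "bil Q Y1 Z * bil g Y2 Z = bil Q Y2 Z * bil g Y1 Z"
    if "ctr Y1 A = 0" "ctr Y2 A = 0" "ctr Z A = 0" for Y1 Y2 Z
    using s1[of "bil g Y2 Z *\<^sub>R Y1 - bil g Y1 Z *\<^sub>R Y2" Z] that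
    by (simp add: ctr_linear_left bil_linear mult.commute)
  have RP: "bil Q R P = l * bil g R P" using R by (simp add: l_def)
  have P1: "bil Q Z P = l * bil g Z P" if "ctr Z A = 0" for Z
    using prp[OF that R(1) P(2)] RP R(2) by simp
  have R1: "bil Q R Z = l * bil g R Z" if "ctr Z A = 0" for Z
  proof -
    have "bil Q Z R * bil g R P = bil g Z R * (l * bil g R P)"
      using prp[OF that P(2) R(1)] RP gc[of P R] Qc[of P R] by (simp add: mult.commute)
    then show ?thesis using R(2) gc[of R Z] Qc[of R Z] by simp
  qed
  have R2: "bil Q Y Z = l * bil g Y Z" if "ctr Y A = 0" "ctr Z A = 0" "bil g R Z \<noteq> 0" for Y Z
    using prp[OF that(1) R(1) that(2)] R1[OF that(2)] that(3) by simp
  have QP: "bil Q X Y = l * bil g X Y" if X: "ctr X A = 0" and Y: "ctr Y A = 0" for X Y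
  proof (cases "bil g R Y = 0")
    case True
    \<comment> \<open>Adding \<open>P\<close> restores a nonzero pairing with \<open>R\<close>; its
      contribution is removed by \<open>P1\<close>.\<close>
    have "bil Q X (Y + P) = l * bil g X (Y + P)"
      by (rule R2[OF X]) (use True R(2) Y P in \<open>auto simp: ctr_linear_left bil_linear\<close>)
    then show ?thesis using P1[OF X] by (simp add: bil_linear algebra_simps)
  qed (use R2[OF X Y] in auto)
  have BP: "l * bil B U X = \<gamma> * bil g U X" if X: "ctr X A = 0" for U X
  proof -
    \<comment> \<open>With \<open>Z\<close> orthogonal to \<open>X\<close> and \<open>Q\<close>
      replaced by \<open>l * g\<close>, both subtracted products in \<open>star\<close>
      vanish.\<close>
    obtain Z where Z: "Z \<noteq> 0" "ctr Z A = 0" "bil g Z X = 0" using perp by blast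
    obtain Y where Y: "ctr Y A = 0" "bil g Y Z \<noteq> 0" using nd[OF Z(2,1)] by blast
    have "bil g X Z = 0" using Z(3) gc by simp
    then have "bil B U X * (l * bil g Y Z) = \<gamma> * (bil g U X * bil g Y Z)"
      using star[OF X Y(1) Z(2), of U] QP[OF Y(1) Z(2)] QP[OF X Z(2)] by simp
    then show ?thesis using Y(2) by (simp add: mult.commute)
  qed
  have "l \<noteq> 0" using BP[OF P(2), of R] R(2) \<gamma> by auto
  then show ?thesis using that QP BP by blast
qed

section \<open>Algebraic consequences of the recurrence at a point\<close>

text \<open>\<open>K\<close> and \<open>B\<close> are the values at a point of \<open>R - \<psi> G\<close> and \<open>\<nabla>A\<close>; \<open>recurrence\<close> is the second
  Bianchi identity and \<open>recurrence_deriv\<close> its covariant derivative; \<open>h\<close> is the inverse metric.\<close>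

locale curvature_algebra =
  fixes g h :: "'n::finite \<Rightarrow> 'n \<Rightarrow> real" and A :: "'n \<Rightarrow> real"
    and K :: "'n \<Rightarrow> 'n \<Rightarrow> 'n \<Rightarrow> 'n \<Rightarrow> real" and B :: "'n \<Rightarrow> 'n \<Rightarrow> real" and b A2 :: real
  assumes dim: "CARD('n) > 3"
    and gs: "g i j = g j i" and hs: "h i j = h j i"
    and gh: "(\<Sum>j\<in>UNIV. g i j * h j k) = (if i = k then 1 else 0)"
    and K_left: "K j k l m = - K k j l m" and K_right: "K j k l m = - K j k m l"
    and K_cyclic: "K j k l m + K j l m k + K j m k l = 0"
    and A2: "A2 = (\<Sum>i\<in>UNIV. \<Sum>j\<in>UNIV. h i j * A i * A j)" and A2_nz: "A2 \<noteq> 0"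
    and b: "b \<noteq> 0"
    and recurrence: "A i * K j k l m + A l * K j k m i + A m * K j k i l = 0"
    and recurrence_deriv:
      "B s i * K j k l m + B s l * K j k m i + B s m * K j k i l
      + b / 2 * (A i * (A j * (g m s * g k l - g m k * g s l) + A k * (g m j * g s l - g m s * g j l))
         + A l * (A j * (g i s * g k m - g i k * g s m) + A k * (g i j * g s m - g i s * g j m))
         + A m * (A j * (g l s * g k i - g l k * g s i) + A k * (g l j * g s i - g l s * g j i))) = 0"
begin

text \<open>The metric dual of \<open>A\<close>; since \<open>A2\<close> is nonzero it is
  transversal to the hyperplane \<open>ctr _ A = 0\<close>.\<close>

definition V :: "real^'n" where "V = (\<chi> i. \<Sum>j\<in>UNIV. h i j * A j)"

definition P :: "'n \<Rightarrow> 'n \<Rightarrow> 'n \<Rightarrow> real" where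
  "P j k m = ctr V (\<lambda>i. K j k i m)"

definition Q :: "'n \<Rightarrow> 'n \<Rightarrow> real" where
  "Q k m = ctr V (\<lambda>j. P j k m)"

lemma ctr_V_A: "ctr V A = A2"
  unfolding ctr_def V_def A2 by (simp add: sum_distrib_right sum_distrib_left mult_ac)

lemma ctr_V_g: "ctr V (g i) = A i"
proof -
  have "ctr V (g i) = (\<Sum>j\<in>UNIV. \<Sum>k\<in>UNIV. g i j * h j k * A k)"
    unfolding ctr_def V_def by (simp add: sum_distrib_left sum_distrib_right mult_ac)
  also have "\<dots> = (\<Sum>k\<in>UNIV. (\<Sum>j\<in>UNIV. g i j * h j k) * A k)"
    unfolding sum_distrib_right by (rule sum.swap)
  finally have "ctr V (g i) = (\<Sum>k\<in>UNIV. (\<Sum>j\<in>UNIV. g i j * h j k) * A k)" .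
  then show ?thesis by (simp add: gh if_distrib[of "\<lambda>z. z * _"] cong: if_cong)
qed

lemma ctr_V_g': "ctr V (\<lambda>j. g j i) = A i"
proof -
  have "(\<lambda>j. g j i) = g i" by (rule ext) (rule gs)
  then show ?thesis by (simp add: ctr_V_g)
qed

text \<open>The classical octahedron argument: four cyclic identities are combined and reduced by
  the two antisymmetries.\<close>

lemma K_pair: "K j k l m = K l m j k"
  using K_cyclic[of j k l m] K_cyclic[of k l m j] K_cyclic[of l m j k] K_cyclic[of m j k l]
    K_left[of j k l m] K_left[of j l m k] K_left[of j m k l] K_left[of k l m j] K_left[of m l j k] K_left[of m k l j]
    K_right[of k l m j] K_right[of l m j k] K_right[of l j k m] K_right[of m j k l] K_right[of m k l j] K_right[of k j l m]
    K_right[of j l m k] K_right[of j m k l] K_left[of l m j k] K_left[of l j k m] K_left[of l k m j]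
    K_right[of k m j l] K_right[of l k m j] K_right[of m l j k] K_left[of k m j l] K_right[of j k l m]
  by linarith

lemma ctr_V_K: "ctr V (K j k m) = - P j k m"
proof -
  have "K j k m = (\<lambda>i. - K j k i m)" by (rule ext) (rule K_right)
  then show ?thesis by (simp add: P_def ctr_linear)
qed

text \<open>Contraction of \<open>recurrence\<close> with \<open>V\<close> over
  \<open>i\<close>.\<close>

lemma K_eq_P: "A2 * K j k l m = A l * P j k m - A m * P j k l"
proof -
  have "ctr V (\<lambda>i. A i * K j k l m + A l * K j k m i + A m * K j k i l) = 0"
    by (simp only: recurrence ctr_linear)
  then show ?thesis
    by (simp add: ctr_linear ctr_V_A ctr_V_K P_def[symmetric])
qed

text \<open>By \<open>K_pair\<close>, \<open>K_eq_P\<close> also splits off \<open>A\<close> in the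
  first index pair; a further contraction with \<open>V\<close> turns \<open>P\<close> into
  \<open>Q\<close>. Thus \<open>K\<close> is determined by \<open>A\<close> and
  \<open>Q\<close>.\<close>

lemma P_eq_Q: "A2 * P j k m = A j * Q m k - A k * Q m j"
proof -
  have *: "A2 * K j k i m = A j * P i m k - A k * P i m j" for i
    using K_eq_P[of i m j k] K_pair[of j k i m] by simp
  have "A2 * P j k m = ctr V (\<lambda>i. A2 * K j k i m)"
    by (simp add: P_def ctr_linear)
  then show ?thesis
    unfolding * by (simp add: ctr_linear Q_def)
qed

lemma Q_sym: "Q k m = Q m k"
proof -
  have "Q k m = ctr V (\<lambda>i. ctr V (\<lambda>j. K j k i m))"
    unfolding Q_def P_def by (rule ctr_swap)
  also have "\<dots> = ctr V (\<lambda>i. ctr V (\<lambda>j. K i m j k))"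
    by (subst K_pair) simp
  finally show ?thesis unfolding Q_def P_def .
qed

text \<open>\<open>V\<close> fills both slots of an antisymmetric pair of \<open>K\<close>. Hence
  \<open>Q\<close> is determined by its values on the hyperplane.\<close>

lemma Q_V: "ctr V (Q k) = 0"
proof -
  have "ctr V (\<lambda>k. Q k m) = ctr V (\<lambda>j. ctr V (\<lambda>k. P j k m))" for m
    unfolding Q_def by (rule ctr_swap)
  moreover have "ctr V (\<lambda>j. ctr V (\<lambda>k. P j k m)) = - ctr V (\<lambda>j. ctr V (\<lambda>k. P k j m))" for m
    unfolding P_def ctr_linear(3)[symmetric] by (subst K_left) simp
  ultimately have "ctr V (\<lambda>k. Q k m) = - ctr V (\<lambda>k. Q k m)" for m
    unfolding Q_def by simp
  then have "ctr V (\<lambda>j. Q j k) = 0" by simp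
  moreover have "(\<lambda>j. Q j k) = Q k" by (rule ext) (rule Q_sym)
  ultimately show ?thesis by simp
qed

text \<open>\<open>recurrence_deriv\<close> is contracted with \<open>V\<close> in \<open>i\<close>
  and then in \<open>j\<close>. Remaining terms with a factor \<open>A k\<close>, \<open>A l\<close>
  or \<open>A m\<close> are killed by \<open>Z\<close>, \<open>X\<close>, \<open>Y\<close> in these
  slots, while \<open>U\<close> fills the derivative slot \<open>s\<close> and is
  unrestricted.\<close>

lemma wedge_identity:
  assumes X: "ctr X A = 0" and Y: "ctr Y A = 0" and Z: "ctr Z A = 0"
  shows "bil B U X * bil Q Y Z - bil B U Y * bil Q X Z
    = (- b / 2 * A2^2) * (bil g U X * bil g Y Z - bil g U Y * bil g X Z)"
proof -
  define BV where "BV s = ctr V (B s)" for s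
  have c1: "BV s * K j k l m - B s l * P j k m + B s m * P j k l
      + b / 2 * (A2 * (A j * (g m s * g k l - g m k * g s l) + A k * (g m j * g s l - g m s * g j l))
         + A l * (A j * (A s * g k m - A k * g s m) + A k * (A j * g s m - A s * g j m))
         + A m * (A j * (g l s * A k - g l k * A s) + A k * (g l j * A s - g l s * A j))) = 0" for s j k l m
  proof -
    have "ctr V (\<lambda>i. B s i * K j k l m + B s l * K j k m i + B s m * K j k i l
      + b / 2 * (A i * (A j * (g m s * g k l - g m k * g s l) + A k * (g m j * g s l - g m s * g j l))
         + A l * (A j * (g i s * g k m - g i k * g s m) + A k * (g i j * g s m - g i s * g j m))
         + A m * (A j * (g l s * g k i - g l k * g s i) + A k * (g l j * g s i - g l s * g j i))))
      = BV s * K j k l m - B s l * P j k m + B s m * P j k l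
      + b / 2 * (A2 * (A j * (g m s * g k l - g m k * g s l) + A k * (g m j * g s l - g m s * g j l))
         + A l * (A j * (A s * g k m - A k * g s m) + A k * (A j * g s m - A s * g j m))
         + A m * (A j * (g l s * A k - g l k * A s) + A k * (g l j * A s - g l s * A j)))"
      by (simp add: ctr_linear ctr_V_A ctr_V_g ctr_V_g' ctr_V_K P_def[symmetric] BV_def)
    then show ?thesis unfolding recurrence_deriv by (simp add: ctr_linear)
  qed
  define N where "N k l m = ctr V (\<lambda>j. K j k l m)" for k l m
  \<comment> \<open>So the term with \<open>BV\<close>, too, carries a factor \<open>A l\<close> or
    \<open>A m\<close>.\<close>
  have N: "A2 * N k l m = A l * Q k m - A m * Q k l" for k l m
  proof -
    have "A2 * N k l m = ctr V (\<lambda>j. A2 * K j k l m)" by (simp add: N_def ctr_linear)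
    then show ?thesis unfolding K_eq_P by (simp add: ctr_linear Q_def)
  qed
  have c2: "BV s * N k l m - B s l * Q k m + B s m * Q k l
      + b / 2 * (A2 * (A2 * (g m s * g k l - g m k * g s l) + A k * (A m * g s l - g m s * A l))
         + A l * (A2 * (A s * g k m - A k * g s m) + A k * (A2 * g s m - A s * A m))
         + A m * (A2 * (g l s * A k - g l k * A s) + A k * (A l * A s - g l s * A2))) = 0" for s k l m
  proof -
    have "ctr V (\<lambda>j. BV s * K j k l m - B s l * P j k m + B s m * P j k l
      + b / 2 * (A2 * (A j * (g m s * g k l - g m k * g s l) + A k * (g m j * g s l - g m s * g j l))
         + A l * (A j * (A s * g k m - A k * g s m) + A k * (A j * g s m - A s * g j m))
         + A m * (A j * (g l s * A k - g l k * A s) + A k * (g l j * A s - g l s * A j))))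
      = BV s * N k l m - B s l * Q k m + B s m * Q k l
      + b / 2 * (A2 * (A2 * (g m s * g k l - g m k * g s l) + A k * (A m * g s l - g m s * A l))
         + A l * (A2 * (A s * g k m - A k * g s m) + A k * (A2 * g s m - A s * A m))
         + A m * (A2 * (g l s * A k - g l k * A s) + A k * (A l * A s - g l s * A2)))"
      by (simp add: ctr_linear ctr_V_A ctr_V_g ctr_V_g' Q_def[symmetric] N_def[symmetric])
    then show ?thesis unfolding c1 by (simp add: ctr_linear)
  qed
  define d where "d = b / 2"
  \<comment> \<open>\<open>W1\<close>, \<open>W2\<close>, \<open>W3\<close> collect the coefficients
    of \<open>A l\<close>, \<open>A m\<close>, \<open>A k\<close>. What matters is that each is free
    of the index of its factor.\<close>
  define W1 where "W1 s k m = - (BV s * Q k m / A2) - d * (A2 * (A s * g k m - A k * g s m) + A k * (A2 * g s m - A s * A m))" for s k m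
  define W2 where "W2 s k l = BV s * Q k l / A2 - d * (A2 * (g l s * A k - g l k * A s) + A k * (A l * A s - g l s * A2))" for s k l
  define W3 where "W3 s l m = - (d * A2 * (A m * g s l - g m s * A l))" for s l m
  have c3: "- B s l * Q k m + B s m * Q k l + d * A2^2 * (g s m * g k l - g k m * g s l)
     = A l * W1 s k m + A m * W2 s k l + A k * W3 s l m" for s k l m
  proof -
    have "A2 * (BV s * N k l m) = BV s * (A l * Q k m - A m * Q k l)"
      unfolding N[symmetric] by simp
    also have "\<dots> = A2 * (A l * (BV s * Q k m / A2) - A m * (BV s * Q k l / A2))"
      using A2_nz by (simp add: right_diff_distrib mult.left_commute)
    finally have "BV s * N k l m = A l * (BV s * Q k m / A2) - A m * (BV s * Q k l / A2)"
      using A2_nz mult_left_cancel by blast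
    then show ?thesis
      using c2[of s k l m, folded d_def] unfolding W1_def W2_def W3_def gs[of m s] gs[of m k] power2_eq_square
      by algebra
  qed
  have "ctr U (\<lambda>s. ctr Z (\<lambda>k. ctr X (\<lambda>l. ctr Y (\<lambda>m.
      - B s l * Q k m + B s m * Q k l + d * A2^2 * (g s m * g k l - g k m * g s l)))))
    = ctr U (\<lambda>s. ctr Z (\<lambda>k. ctr X (\<lambda>l. ctr Y (\<lambda>m. A l * W1 s k m + A m * W2 s k l + A k * W3 s l m))))"
    unfolding c3 ..
  also have "\<dots> = 0"
    by (simp add: ctr_linear X Y Z)
  finally have "- bil B U X * bil Q Z Y + bil B U Y * bil Q Z X
      + d * A2^2 * (bil g U Y * bil g Z X - bil g Z Y * bil g U X) = 0"
    by (simp add: ctr_linear bil_def)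
  then show ?thesis
    unfolding bil_commute[of g Z, OF gs] bil_commute[of Q Z, OF Q_sym]
    by (simp add: d_def algebra_simps)
qed

lemma g_nondegenerate:
  assumes "\<And>Y. bil g X Y = 0"
  shows "X = 0"
proof -
  have z: "(\<Sum>i\<in>UNIV. X $ i * g i j) = 0" for j
    using assms[of "axis j 1"] unfolding bil_def ctr_axis by (simp add: ctr_def)
  have "X $ k = (\<Sum>i\<in>UNIV. X $ i * (\<Sum>j\<in>UNIV. g i j * h j k))" for k
    by (simp add: gh if_distrib[of "\<lambda>z. _ * z"] cong: if_cong)
  also have "\<dots> k = (\<Sum>j\<in>UNIV. (\<Sum>i\<in>UNIV. X $ i * g i j) * h j k)" for k
    unfolding sum_distrib_left sum_distrib_right by (subst sum.swap) (simp add: mult_ac)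
  finally show ?thesis by (simp add: z vec_eq_iff)
qed

text \<open>\<open>wedge_identity_umbilic\<close> gives \<open>Q\<close> on the hyperplane only; the
  formula extends to all components because \<open>Q\<close> annihilates \<open>V\<close>.\<close>

lemma umbilic:
  obtains l where "l \<noteq> 0" "\<And>U X. ctr X A = 0 \<Longrightarrow> l * bil B U X = - b / 2 * A2^2 * bil g U X"
    "\<And>i j. Q i j = l * (g i j - A i * A j / A2)"
proof -
  have gV: "bil g V X = ctr X A" for X
    using bil_commute[of g V X, OF gs] by (simp add: bil_def ctr_V_g)
  have "- b / 2 * A2^2 \<noteq> 0" using b A2_nz by simp
  from wedge_identity_umbilic[OF dim this gs Q_sym g_nondegenerate gV _ wedge_identity, unfolded ctr_V_A, OF _ A2_nz]
  obtain l where l: "l \<noteq> 0" "\<And>X Y. ctr X A = 0 \<Longrightarrow> ctr Y A = 0 \<Longrightarrow> bil Q X Y = l * bil g X Y"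
    "\<And>U X. ctr X A = 0 \<Longrightarrow> l * bil B U X = - b / 2 * A2^2 * bil g U X" by blast
  have "Q i j = l * (g i j - A i * A j / A2)" for i j
  proof -
    \<comment> \<open>Projection of a basis vector onto the hyperplane along \<open>V\<close>; the
      \<open>g\<close>-products of these projections are
      \<open>g i j - A i * A j / A2\<close>.\<close>
    define p where "p i = axis i (1::real) - (A i / A2) *\<^sub>R V" for i
    have "ctr (p i) A = 0" for i
      using A2_nz by (simp add: p_def ctr_linear_left ctr_axis ctr_V_A)
    then have "bil Q (p i) (p j) = l * bil g (p i) (p j)" using l(2) by blast
    moreover have "bil g (axis i 1) V = A i" "bil g V (axis j 1) = A j" "bil g V V = A2"
      by (simp_all add: bil_def ctr_axis ctr_V_g ctr_V_g' ctr_V_A)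
    moreover have "bil Q X V = 0" "bil Q V X = 0" for X
      using bil_commute[of Q V X, OF Q_sym] by (simp_all add: bil_def Q_V ctr_linear)
    ultimately show ?thesis
      using A2_nz by (simp add: p_def bil_linear bil_axis field_simps)
  qed
  then show ?thesis using that l by blast
qed

text \<open>Inserting \<open>Q\<close> into \<open>P_eq_Q\<close> and \<open>K_eq_P\<close> makes
  \<open>K\<close> explicit, the cubic terms in \<open>A\<close> of \<open>P\<close> cancelling by
  antisymmetry. The trace then reduces to the contractions \<open>t1\<close> to
  \<open>t4\<close>.\<close>

lemma ricci_part:
  assumes Q: "\<And>i j. Q i j = l * (g i j - A i * A j / A2)"
  shows "(\<Sum>m\<in>UNIV. \<Sum>k\<in>UNIV. h m k * K i m j k)
    = l / A2^2 * ((real CARD('n) - 2) * A i * A j + A2 * g i j)"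
proof -
  have K: "K j k l' m = l / A2^2 * (A l' * (A j * g m k - A k * g m j) - A m * (A j * g l' k - A k * g l' j))"
    for j k l' m
  proof -
    have "A2 * (A2 * K j k l' m) = A l' * (A2 * P j k m) - A m * (A2 * P j k l')"
      unfolding K_eq_P by (simp add: right_diff_distrib mult.left_commute)
    then have "A2^2 * K j k l' m = l * (A l' * (A j * g m k - A k * g m j) - A m * (A j * g l' k - A k * g l' j))"
      unfolding P_eq_Q Q by (simp add: power2_eq_square algebra_simps)
    then show ?thesis using A2_nz by (simp add: field_simps)
  qed
  have t1: "(\<Sum>m\<in>UNIV. \<Sum>k\<in>UNIV. h m k * g k m) = real CARD('n)"
    using gh by (subst sum.swap) (simp add: mult.commute)
  have t2: "(\<Sum>m\<in>UNIV. \<Sum>k\<in>UNIV. h m k * (A m * g k i)) = A i" for i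
  proof -
    have "(\<Sum>m\<in>UNIV. \<Sum>k\<in>UNIV. h m k * (A m * g k i)) = ctr V (\<lambda>k. g k i)"
      unfolding ctr_def V_def sum_distrib_right vec_lambda_beta
      by (subst sum.swap) (intro sum.cong refl, simp add: hs mult_ac)
    then show ?thesis by (simp add: ctr_V_g')
  qed
  have t3: "(\<Sum>m\<in>UNIV. \<Sum>k\<in>UNIV. h m k * (A k * g j m)) = A j" for j
  proof -
    have "(\<Sum>m\<in>UNIV. \<Sum>k\<in>UNIV. h m k * (A k * g j m)) = ctr V (g j)"
      unfolding ctr_def V_def sum_distrib_right vec_lambda_beta
      by (intro sum.cong refl) (simp add: mult_ac)
    then show ?thesis by (simp add: ctr_V_g)
  qed
  have t4: "(\<Sum>m\<in>UNIV. \<Sum>k\<in>UNIV. h m k * (A k * A m)) = A2"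
    unfolding A2 by (simp add: mult_ac)
  have "(\<Sum>m\<in>UNIV. \<Sum>k\<in>UNIV. h m k * K i m j k) = (\<Sum>m\<in>UNIV. \<Sum>k\<in>UNIV. l / A2^2 *
     (A i * A j * (h m k * g k m) - A j * (h m k * (A m * g k i)) - A i * (h m k * (A k * g j m))
      + g j i * (h m k * (A k * A m))))"
    unfolding K by (intro sum.cong refl) (simp add: algebra_simps)
  also have "\<dots> = l / A2^2 * (A i * A j * real CARD('n) - A j * A i - A i * A j + g j i * A2)"
    unfolding sum.distrib sum_subtractf sum_distrib_left[symmetric] t1 t2 t3 t4 ..
  finally show ?thesis by (simp add: gs[of j i] algebra_simps)
qed

end

section \<open>The recurrence in a chart\<close>

context metric_chart begin

lemma pd_metric_christoffel:
  assumes "x \<in> dom_of c"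
  shows "pd c s (\<lambda>y. g c y i j) x
    = (\<Sum>a\<in>UNIV. \<Gamma> x a s i * g c x a j) + (\<Sum>a\<in>UNIV. \<Gamma> x a s j * g c x i a)"
proof -
  have "(\<Sum>a\<in>UNIV. \<Gamma> x a s i * g c x a j) = christoffel_low x j s i"
    unfolding metric_christoffel[OF assms, symmetric] by (intro sum.cong refl) (simp add: g_sym[OF assms] mult.commute)
  moreover have "(\<Sum>a\<in>UNIV. \<Gamma> x a s j * g c x i a) = christoffel_low x i s j"
    unfolding metric_christoffel[OF assms, symmetric] by (intro sum.cong refl) (simp add: mult.commute)
  ultimately show ?thesis using pd_metric[OF assms] by simp
qed

text \<open>\<open>G_tensor\<close> is a polynomial in the parallel tensor \<open>g\<close>; with
  \<open>L\<close> for the lowered symbols the cancellation is plain algebra.\<close>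

lemma cov_deriv4_G:
  assumes x: "x \<in> dom_of c"
  shows "cov_deriv4 g c (G_tensor g c) x s j k l m = 0"
proof -
  define L where "L i j = (\<Sum>a\<in>UNIV. \<Gamma> x a s i * g c x a j)" for i j
  have L': "(\<Sum>a\<in>UNIV. \<Gamma> x a s i * g c x j a) = L i j" for i j
    unfolding L_def by (intro sum.cong refl) (simp add: g_sym[OF x])
  have pd: "pd c s (\<lambda>y. g c y i j) x = L i j + L j i" for i j
    using pd_metric_christoffel[OF x] L' by (simp add: L_def)
  have S: "(\<Sum>a\<in>UNIV. \<Gamma> x a s i * (f a * r)) = (\<Sum>a\<in>UNIV. \<Gamma> x a s i * f a) * r"
    "(\<Sum>a\<in>UNIV. \<Gamma> x a s i * (r * f a)) = (\<Sum>a\<in>UNIV. \<Gamma> x a s i * f a) * r" for i r f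
    by (simp_all add: sum_distrib_left mult_ac)
  have "pd c s (\<lambda>y. G_tensor g c y j k l m) x
    = (L m j + L j m) * g c x k l + g c x m j * (L k l + L l k)
      - (L m k + L k m) * g c x j l - g c x m k * (L j l + L l j)"
    unfolding G_tensor_def using x
    by (simp add: pd_diff pd_mult[OF chart] differentiable_in_intros smooth_diff pd algebra_simps)
  then show ?thesis
    unfolding cov_deriv4_def G_tensor_def
    by (simp add: right_diff_distrib sum_subtractf S L_def[symmetric] L') (simp add: algebra_simps)
qed

lemma G_smooth: "smooth_in c (\<lambda>x. G_tensor g c x j k l m)"
  unfolding G_tensor_def by (intro smooth_in_diff[OF chart] smooth_in_mult[OF chart] g_smooth)

end

text \<open>The hypotheses seen in a single chart. \<open>norm_nz\<close> is what splits off the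
  direction of \<open>A\<close>; the sign of the norm enters with the normalization of
  \<open>u\<close>.\<close>

locale recurrent_chart = metric_chart M c g
  for M :: "'m topology" and c :: "('m, 'n::finite) chart" and g :: "('m, 'n) tensor2" +
  fixes A :: "('m, 'n) tensor1" and \<beta> \<psi> :: "'m \<Rightarrow> real"
  assumes A_smooth: "\<And>i. smooth_in c (\<lambda>x. A c x i)"
    and A_closed: "\<And>x i j. x \<in> dom_of c \<Longrightarrow> pd c i (\<lambda>y. A c y j) x = pd c j (\<lambda>y. A c y i) x"
    and psi_smooth: "smooth_in c \<psi>"
    and psi_pd: "\<And>x j. x \<in> dom_of c \<Longrightarrow> pd c j \<psi> x = \<beta> x * A c x j"
    and beta_nz: "\<And>x. x \<in> dom_of c \<Longrightarrow> \<beta> x \<noteq> 0"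
    and norm_nz: "\<And>x. x \<in> dom_of c \<Longrightarrow> norm_sq g A c x \<noteq> 0"
    and dim: "CARD('n) > 3"
    and recurrent: "\<And>x i j k l m. x \<in> dom_of c \<Longrightarrow> cov_deriv4 g c (riemann g c) x i j k l m =
          A c x i * riemann g c x j k l m
          + (\<beta> x - \<psi> x) * A c x i * G_tensor g c x j k l m
          + \<beta> x / 2 *
              (A c x j * G_tensor g c x i k l m + A c x k * G_tensor g c x j i l m
               + A c x l * G_tensor g c x j k i m + A c x m * G_tensor g c x j k l i)"
begin

definition K :: "'m \<Rightarrow> 'n \<Rightarrow> 'n \<Rightarrow> 'n \<Rightarrow> 'n \<Rightarrow> real" where
  "K x j k l m = Rm x j k l m - \<psi> x * G_tensor g c x j k l m"

definition cov_A :: "'m \<Rightarrow> 'n \<Rightarrow> 'n \<Rightarrow> real" where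
  "cov_A x i j = pd c i (\<lambda>y. A c y j) x - (\<Sum>a\<in>UNIV. \<Gamma> x a i j * A c x a)"

text \<open>In the cyclic sum the terms with \<open>A c x j\<close> and \<open>A c x k\<close>
  vanish by the first Bianchi identity of \<open>G_tensor\<close>; the other bracket terms add up to
  \<open>- \<beta>\<close> and turn \<open>\<beta> - \<psi>\<close> into \<open>- \<psi>\<close>,
  which completes \<open>K\<close>.\<close>

lemma K_recurrence:
  assumes x: "x \<in> dom_of c"
  shows "A c x i * K x j k l m + A c x l * K x j k m i + A c x m * K x j k i l = 0"
proof -
  have "0 = cov_deriv4 g c Rm x i j k l m + cov_deriv4 g c Rm x l j k m i + cov_deriv4 g c Rm x m j k i l"
    using second_bianchi[OF x] by simp
  also have "\<dots> = A c x i * K x j k l m + A c x l * K x j k m i + A c x m * K x j k i l"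
    unfolding recurrent[OF x] K_def G_tensor_def
    by (simp add: g_sym[OF x] field_simps)
  finally show ?thesis by simp
qed

text \<open>\<open>G_tensor\<close> is parallel, and the derivative of \<open>\<psi>\<close>
  contributes the \<open>- \<beta>\<close> that again turns \<open>\<beta> - \<psi>\<close> into
  \<open>- \<psi>\<close>.\<close>

lemma cov_K:
  assumes x: "x \<in> dom_of c"
  shows "cov_deriv4 g c K x s j k l m = A c x s * K x j k l m
    + \<beta> x / 2 * (A c x j * G_tensor g c x s k l m + A c x k * G_tensor g c x j s l m
               + A c x l * G_tensor g c x j k s m + A c x m * G_tensor g c x j k l s)"
proof -
  have "pd c s (\<lambda>y. K y j k l m) x = pd c s (\<lambda>y. Rm y j k l m) x
      - \<psi> x * pd c s (\<lambda>y. G_tensor g c y j k l m) x - \<beta> x * A c x s * G_tensor g c x j k l m"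
    unfolding K_def using x smooth_in_differentiable[OF G_smooth x] smooth_in_differentiable[OF psi_smooth x]
    by (simp add: pd_diff pd_mult[OF chart] differentiable_in_intros smooth_diff psi_pd)
  then have "cov_deriv4 g c K x s j k l m = cov_deriv4 g c Rm x s j k l m
      - \<psi> x * cov_deriv4 g c (G_tensor g c) x s j k l m - \<beta> x * A c x s * G_tensor g c x j k l m"
    unfolding cov_deriv4_def K_def
    by (simp add: right_diff_distrib sum_subtractf sum_distrib_left mult_ac)
  then show ?thesis
    unfolding cov_deriv4_G[OF x] recurrent[OF x] K_def by (simp add: algebra_simps)
qed

lemma K_smooth: "smooth_in c (\<lambda>x. K x j k l m)"
  unfolding K_def
  by (intro smooth_in_diff[OF chart] smooth_in_mult[OF chart] riemann_smooth psi_smooth G_smooth)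

text \<open>Leibniz rule for the covariant derivative of \<open>K_recurrence\<close>, which holds on
  the whole chart and so may be differentiated.\<close>

lemma K_recurrence_covariant:
  assumes x: "x \<in> dom_of c"
  shows "cov_A x s i * K x j k l m + cov_A x s l * K x j k m i + cov_A x s m * K x j k i l
    + A c x i * cov_deriv4 g c K x s j k l m + A c x l * cov_deriv4 g c K x s j k m i
    + A c x m * cov_deriv4 g c K x s j k i l = 0"
proof -
  have d: "differentiable_in c (\<lambda>y. A c y i) x" "differentiable_in c (\<lambda>y. K y j k l m) x" for i j k l m
    using smooth_in_differentiable[OF _ x] A_smooth K_smooth by blast+
  have "pd c s (\<lambda>y. A c y i * K y j k l m + A c y l * K y j k m i + A c y m * K y j k i l) x = pd c s (\<lambda>y. 0) x"
    by (rule pd_cong[OF chart x]) (rule K_recurrence)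
  then have D: "pd c s (\<lambda>y. A c y i) x * K x j k l m + A c x i * pd c s (\<lambda>y. K y j k l m) x
     + pd c s (\<lambda>y. A c y l) x * K x j k m i + A c x l * pd c s (\<lambda>y. K y j k m i) x
     + pd c s (\<lambda>y. A c y m) x * K x j k i l + A c x m * pd c s (\<lambda>y. K y j k i l) x = 0"
    using d by (simp add: pd_add pd_mult[OF chart x] differentiable_in_intros pd_const algebra_simps)
  define G where "G a i = \<Gamma> x a s i" for a i
  \<comment> \<open>Each Christoffel correction is the recurrence with one index replaced by
    \<open>a\<close>, hence zero; added to \<open>D\<close>, these corrections assemble the
    covariant derivatives.\<close>
  have R: "(\<Sum>a\<in>UNIV. G a i * (A c x a * K x j k l m + A c x l * K x j k m a + A c x m * K x j k a l)) = 0"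
    "(\<Sum>a\<in>UNIV. G a j * (A c x i * K x a k l m + A c x l * K x a k m i + A c x m * K x a k i l)) = 0"
    "(\<Sum>a\<in>UNIV. G a k * (A c x i * K x j a l m + A c x l * K x j a m i + A c x m * K x j a i l)) = 0"
    "(\<Sum>a\<in>UNIV. G a l * (A c x i * K x j k a m + A c x a * K x j k m i + A c x m * K x j k i a)) = 0"
    "(\<Sum>a\<in>UNIV. G a m * (A c x i * K x j k l a + A c x l * K x j k a i + A c x a * K x j k i l)) = 0"
    by (simp_all add: K_recurrence[OF x])
  \<comment> \<open>Four shapes: the summed index sits in \<open>K\<close> throughout, or on
    \<open>A\<close> in the first, second or third product.\<close>
  have E: "(\<Sum>a\<in>UNIV. G a q * (u * f a + v * h a + w * e a))
     = u * (\<Sum>a\<in>UNIV. G a q * f a) + v * (\<Sum>a\<in>UNIV. G a q * h a) + w * (\<Sum>a\<in>UNIV. G a q * e a)"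
    "(\<Sum>a\<in>UNIV. G a q * (f a * u + v * h a + w * e a))
     = u * (\<Sum>a\<in>UNIV. G a q * f a) + v * (\<Sum>a\<in>UNIV. G a q * h a) + w * (\<Sum>a\<in>UNIV. G a q * e a)"
    "(\<Sum>a\<in>UNIV. G a q * (u * f a + h a * v + w * e a))
     = u * (\<Sum>a\<in>UNIV. G a q * f a) + v * (\<Sum>a\<in>UNIV. G a q * h a) + w * (\<Sum>a\<in>UNIV. G a q * e a)"
    "(\<Sum>a\<in>UNIV. G a q * (u * f a + v * h a + e a * w))
     = u * (\<Sum>a\<in>UNIV. G a q * f a) + v * (\<Sum>a\<in>UNIV. G a q * h a) + w * (\<Sum>a\<in>UNIV. G a q * e a)"
    for q u v w f h e
    by (simp_all add: algebra_simps sum.distrib sum_distrib_left)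
  note R' = R(1)[unfolded E(2)] R(2)[unfolded E(1)] R(3)[unfolded E(1)] R(4)[unfolded E(3)] R(5)[unfolded E(4)]
  show ?thesis
    unfolding cov_deriv4_def cov_A_def G_def[symmetric]
    using D R' by (simp add: algebra_simps)
qed

lemma curvature_algebra_at:
  assumes x: "x \<in> dom_of c"
  shows "curvature_algebra (g c x) (inv_metric g c x) (A c x) (K x) (cov_A x) (\<beta> x) (norm_sq g A c x)"
proof
  fix s i j k l m :: 'n
  show "g c x i j = g c x j i" "inv_metric g c x i j = inv_metric g c x j i"
    using g_sym inv_metric_sym x by blast+
  show "(\<Sum>j\<in>UNIV. g c x i j * inv_metric g c x j k) = (if i = k then 1 else 0)"
    by (rule metric_mult_inv[OF x])
  show "K x j k l m = - K x k j l m"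
    unfolding K_def G_tensor_def using riemann_antisym_left[OF x, of j k l m] by (simp add: algebra_simps)
  show "K x j k l m = - K x j k m l"
    unfolding K_def G_tensor_def using riemann_antisym_right[of x j k l m]
    by (simp add: g_sym[OF x, of m] g_sym[OF x, of l] algebra_simps)
  show "K x j k l m + K x j l m k + K x j m k l = 0"
    unfolding K_def G_tensor_def using first_bianchi[OF x, of j k l m]
    by (simp add: g_sym[OF x] algebra_simps)
  show "A c x i * K x j k l m + A c x l * K x j k m i + A c x m * K x j k i l = 0"
    by (rule K_recurrence[OF x])
  show "cov_A x s i * K x j k l m + cov_A x s l * K x j k m i + cov_A x s m * K x j k i l +
      \<beta> x / 2 * (A c x i * (A c x j * (g c x m s * g c x k l - g c x m k * g c x s l) +
          A c x k * (g c x m j * g c x s l - g c x m s * g c x j l)) +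
         A c x l * (A c x j * (g c x i s * g c x k m - g c x i k * g c x s m) +
          A c x k * (g c x i j * g c x s m - g c x i s * g c x j m)) +
         A c x m * (A c x j * (g c x l s * g c x k i - g c x l k * g c x s i) +
          A c x k * (g c x l j * g c x s i - g c x l s * g c x j i))) = 0"
    (is "?L = 0")
  proof -
    have r: "A c x i * K x j k l m + A c x l * K x j k m i + A c x m * K x j k i l = 0"
      by (rule K_recurrence[OF x])
    define d where "d = \<beta> x / 2"
    \<comment> \<open>The terms of \<open>cov_K\<close> with \<open>A c x s\<close> add up to a
      multiple of the recurrence, subtracted here; products of two among \<open>A c x i\<close>,
      \<open>A c x l\<close>, \<open>A c x m\<close> cancel by antisymmetry of
      \<open>G_tensor\<close>.\<close>
    have "?L = cov_A x s i * K x j k l m + cov_A x s l * K x j k m i + cov_A x s m * K x j k i l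
        + A c x i * cov_deriv4 g c K x s j k l m + A c x l * cov_deriv4 g c K x s j k m i
        + A c x m * cov_deriv4 g c K x s j k i l
        - A c x s * (A c x i * K x j k l m + A c x l * K x j k m i + A c x m * K x j k i l)"
      unfolding cov_K[OF x] d_def[symmetric] G_tensor_def
      by (simp add: g_sym[OF x] algebra_simps)
    then show ?thesis
      unfolding r K_recurrence_covariant[OF x] by simp
  qed
qed (use x dim beta_nz norm_nz in \<open>auto simp: norm_sq_def\<close>)

end

section \<open>Ricci tensor and scalar curvature in terms of the umbilic factor\<close>

context recurrent_chart begin

lemma ricci_K: "ricci g c x i j = (\<Sum>m\<in>UNIV. \<Sum>l\<in>UNIV. inv_metric g c x m l * K x i m j l)
    + \<psi> x * (\<Sum>m\<in>UNIV. \<Sum>l\<in>UNIV. inv_metric g c x m l * G_tensor g c x i m j l)"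
  unfolding ricci_def K_def
  by (simp add: right_diff_distrib sum_subtractf sum_distrib_left mult_ac)

lemma trace_metric:
  assumes x: "x \<in> dom_of c"
  shows "(\<Sum>m\<in>UNIV. \<Sum>l\<in>UNIV. inv_metric g c x m l * g c x l m) = real CARD('n)"
  by (simp add: inv_metric_mult[OF x])

lemma trace_G:
  assumes x: "x \<in> dom_of c"
  shows "(\<Sum>m\<in>UNIV. \<Sum>l\<in>UNIV. inv_metric g c x m l * G_tensor g c x i m j l) = (1 - real CARD('n)) * g c x i j"
proof -
  have "(\<Sum>m\<in>UNIV. \<Sum>l\<in>UNIV. inv_metric g c x m l * G_tensor g c x i m j l)
    = (\<Sum>m\<in>UNIV. (\<Sum>l\<in>UNIV. inv_metric g c x m l * g c x l i) * g c x m j)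
      - (\<Sum>m\<in>UNIV. \<Sum>l\<in>UNIV. inv_metric g c x m l * g c x l m) * g c x i j"
    unfolding G_tensor_def by (simp add: right_diff_distrib sum_subtractf sum_distrib_left sum_distrib_right mult_ac)
  also have "(\<Sum>m\<in>UNIV. (\<Sum>l\<in>UNIV. inv_metric g c x m l * g c x l i) * g c x m j) = g c x i j"
    unfolding inv_metric_mult[OF x] by (simp add: if_distrib[of "\<lambda>z. z * _"] cong: if_cong)
  finally show ?thesis
    unfolding trace_metric[OF x] by (simp add: algebra_simps)
qed

text \<open>Combines \<open>ricci_part\<close> with \<open>trace_G\<close>. The relation of
  \<open>l\<close> to \<open>cov_A\<close> is exported because it is what identifies
  \<open>l\<close> across charts; in the trace, \<open>n + (n - 2)\<close> gives the factor
  \<open>2 * (n - 1)\<close>.\<close>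

lemma ricci_form:
  assumes x: "x \<in> dom_of c"
  obtains l where "l \<noteq> 0"
    "\<And>U X. ctr X (A c x) = 0 \<Longrightarrow>
      l * bil (cov_A x) U X = - \<beta> x / 2 * (norm_sq g A c x)^2 * bil (g c x) U X"
    "scalar_curv g c x = 2 * (real CARD('n) - 1) * (l / norm_sq g A c x)
      - real CARD('n) * (real CARD('n) - 1) * \<psi> x"
    "\<And>i j. ricci g c x i j = (l / norm_sq g A c x - (real CARD('n) - 1) * \<psi> x) * g c x i j
      + (real CARD('n) - 2) * (l / norm_sq g A c x) * (A c x i * A c x j / norm_sq g A c x)"
proof -
  interpret curvature_algebra "g c x" "inv_metric g c x" "A c x" "K x" "cov_A x" "\<beta> x" "norm_sq g A c x"
    by (rule curvature_algebra_at[OF x])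
  obtain l where l: "l \<noteq> 0"
    "\<And>U X. ctr X (A c x) = 0 \<Longrightarrow>
      l * bil (cov_A x) U X = - \<beta> x / 2 * (norm_sq g A c x)^2 * bil (g c x) U X"
    "\<And>i j. Q i j = l * (g c x i j - A c x i * A c x j / norm_sq g A c x)"
    using umbilic by blast
  define k where "k = l / norm_sq g A c x"
  define N where "N = real CARD('n)"
  define q where "q = (N - 2) * k / norm_sq g A c x"
  have qA2: "q * norm_sq g A c x = (N - 2) * k" using A2_nz by (simp add: q_def)
  have ric: "ricci g c x i j = (k - (N - 1) * \<psi> x) * g c x i j + q * (A c x i * A c x j)" for i j
    unfolding ricci_K trace_G[OF x] ricci_part[OF l(3)] k_def N_def q_def
    using A2_nz by (simp add: field_simps power2_eq_square)
  have "scalar_curv g c x = (k - (N - 1) * \<psi> x) * (\<Sum>i\<in>UNIV. \<Sum>j\<in>UNIV. inv_metric g c x i j * g c x j i)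
      + q * norm_sq g A c x"
    unfolding scalar_curv_def ric norm_sq_def
    by (simp add: distrib_left sum.distrib sum_distrib_left g_sym[OF x] mult_ac)
  also have "\<dots> = 2 * (N - 1) * k - N * (N - 1) * \<psi> x"
    unfolding trace_metric[OF x] N_def[symmetric] qA2 by (simp add: algebra_simps)
  finally show ?thesis
    using that[OF l(1,2)] ric unfolding k_def N_def q_def by simp
qed

text \<open>Raising \<open>A\<close> instead of the symbols replaces the inverse metric by the
  vector \<open>V\<close>, which transforms simply.\<close>

lemma cov_A_contr:
  assumes x: "x \<in> dom_of c"
  shows "cov_A x i j = pd c i (\<lambda>y. A c y j) x
    - ctr (curvature_algebra.V (inv_metric g c x) (A c x)) (\<lambda>l. christoffel_low x l i j)"
proof -
  interpret curvature_algebra "g c x" "inv_metric g c x" "A c x" "K x" "cov_A x" "\<beta> x" "norm_sq g A c x"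
    by (rule curvature_algebra_at[OF x])
  have "(\<Sum>a\<in>UNIV. \<Gamma> x a i j * A c x a) = (\<Sum>a\<in>UNIV. \<Sum>l\<in>UNIV. inv_metric g c x a l * christoffel_low x l i j * A c x a)"
    unfolding christoffel_def christoffel_low_def
    by (simp add: sum_distrib_left sum_distrib_right mult_ac)
  also have "\<dots> = ctr V (\<lambda>l. christoffel_low x l i j)"
    unfolding ctr_def V_def vec_lambda_beta sum_distrib_right
    by (subst sum.swap) (intro sum.cong refl, simp add: inv_metric_sym[OF x] mult_ac)
  finally show ?thesis unfolding cov_A_def by simp
qed

end

text \<open>Near \<open>x\<close>, \<open>f\<close> read in \<open>c'\<close> is \<open>f\<close>
  read in \<open>c\<close> composed with the transition map; the ordinary chain rule applies because
  the overlap has open image.\<close>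

lemma pd_chain_rule:
  fixes c c' :: "('m, 'n::finite) chart"
  assumes c: "is_chart M c" and c': "is_chart M c'" and x: "x \<in> dom_of c" "x \<in> dom_of c'"
    and tr: "smooth_transition c' c" and f: "differentiable_in c f x"
  shows "pd c' i f x = (\<Sum>a\<in>UNIV. jac c c' x a i * pd c a f x)" and "differentiable_in c' f x"
proof -
  let ?S = "coord c' ` (dom_of c' \<inter> dom_of c)"
  let ?\<Phi> = "\<lambda>y. coord c (point_at c' y)"
  have o: "open ?S" using is_chart_open_image[OF c'] c by (simp add: is_chart_def)
  have xi: "coord c' x \<in> ?S" using x by auto
  have "(\<lambda>y. ?\<Phi> y $ a) differentiable (at (coord c' x))" for a
    using tr xi smooth_on_differentiable unfolding smooth_transition_def by blast
  then have D: "((\<lambda>y. ?\<Phi> y $ a) has_derivative frechet_derivative (\<lambda>y. ?\<Phi> y $ a) (at (coord c' x))) (at (coord c' x))" for a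
    using frechet_derivative_works by blast
  let ?D = "\<lambda>h. \<chi> a. frechet_derivative (\<lambda>y. ?\<Phi> y $ a) (at (coord c' x)) h"
  have \<Phi>: "(?\<Phi> has_derivative ?D) (at (coord c' x))"
    by (subst has_derivative_componentwise_within)
      (use D in \<open>auto simp: Basis_vec_def inner_axis\<close>)
  let ?F = "\<lambda>z. f (point_at c z)"
  let ?F' = "frechet_derivative ?F (at (coord c x))"
  have px: "?\<Phi> (coord c' x) = coord c x" using point_at_coord[OF c' x(2)] by simp
  have F: "(?F has_derivative ?F') (at (?\<Phi> (coord c' x)))"
    using f unfolding differentiable_in_def frechet_derivative_works px .
  have comp: "((\<lambda>y. ?F (?\<Phi> y)) has_derivative (\<lambda>h. ?F' (?D h))) (at (coord c' x))"
    using has_derivative_compose[OF \<Phi> F] .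
  have fc: "((\<lambda>y. f (point_at c' y)) has_derivative (\<lambda>h. ?F' (?D h))) (at (coord c' x))"
    by (rule has_derivative_cong_open[OF o xi, THEN iffD1, OF _ comp])
      (use point_at_coord[OF c] point_at_coord[OF c'] in auto)
  show "differentiable_in c' f x"
    unfolding differentiable_in_def differentiable_def using fc by blast
  have lin: "linear ?F'" using f linear_frechet_derivative unfolding differentiable_in_def by blast
  have "pd c' i f x = ?F' (?D (axis i 1))"
    unfolding pd_def by (rule partial_eqI[OF fc])
  also have "?D (axis i 1) = (\<Sum>a\<in>UNIV. jac c c' x a i *\<^sub>R axis a 1)"
    unfolding vec_eq_iff
    by (simp add: jac_def pd_def partial_def axis_def if_distrib[of "\<lambda>z. _ * z"] cong: if_cong)
  also have "?F' \<dots> = (\<Sum>a\<in>UNIV. jac c c' x a i * ?F' (axis a 1))"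
    by (simp add: linear_sum[OF lin] linear_cmul[OF lin])
  finally show "pd c' i f x = (\<Sum>a\<in>UNIV. jac c c' x a i * pd c a f x)"
    unfolding pd_def[of c] partial_def .
qed

section \<open>Independence of the scalar curvature from the chart\<close>

locale overlapping_charts =
  c1: recurrent_chart M c g A \<beta> \<psi> + c2: recurrent_chart M c' g A \<beta> \<psi>
  for M :: "'m topology" and c c' :: "('m, 'n::finite) chart" and g :: "('m, 'n) tensor2"
    and A :: "('m, 'n) tensor1" and \<beta> \<psi> :: "'m \<Rightarrow> real" +
  assumes transition: "smooth_transition c' c"
    and A_trans: "\<And>x i. x \<in> dom_of c \<inter> dom_of c' \<Longrightarrow>
        A c' x i = (\<Sum>a\<in>UNIV. jac c c' x a i * A c x a)"
    and g_trans: "\<And>x i j. x \<in> dom_of c \<inter> dom_of c' \<Longrightarrow>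
        g c' x i j = (\<Sum>a\<in>UNIV. \<Sum>b\<in>UNIV. jac c c' x a i * jac c c' x b j * g c x a b)"
begin

text \<open>The \<open>i\<close>-th coordinate vector of \<open>c'\<close> in the components of
  \<open>c\<close>.\<close>

definition frame :: "'m \<Rightarrow> 'n \<Rightarrow> real^'n" where
  "frame x i = (\<chi> a. jac c c' x a i)"

text \<open>Second derivatives of the transition map, the source of all inhomogeneous terms
  below.\<close>

definition frame_pd :: "'m \<Rightarrow> 'n \<Rightarrow> 'n \<Rightarrow> real^'n" where
  "frame_pd x k i = (\<chi> a. pd c' k (\<lambda>y. jac c c' y a i) x)"

text \<open>Passage from the \<open>c'\<close>-components of a tangent vector to its
  \<open>c\<close>-components.\<close>

definition push :: "'m \<Rightarrow> real^'n \<Rightarrow> real^'n" where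
  "push x v = (\<Sum>i\<in>UNIV. v $ i *\<^sub>R frame x i)"

lemma ctr_sum_left: "ctr (\<Sum>i\<in>I. v i) f = (\<Sum>i\<in>I. ctr (v i) f)"
  unfolding ctr_def sum_component sum_distrib_right by (rule sum.swap)

lemma ctr_push: "ctr v (\<lambda>i. ctr (frame x i) f) = ctr (push x v) f"
  unfolding push_def ctr_sum_left ctr_linear_left by (simp add: ctr_def)

lemma A_frame: "x \<in> dom_of c \<Longrightarrow> x \<in> dom_of c' \<Longrightarrow> A c' x i = ctr (frame x i) (A c x)"
  by (simp add: A_trans ctr_def frame_def)

lemma g_frame: "x \<in> dom_of c \<Longrightarrow> x \<in> dom_of c' \<Longrightarrow> g c' x i j = bil (g c x) (frame x i) (frame x j)"
  by (simp add: g_trans bil_def ctr_def frame_def sum_distrib_left mult_ac)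

lemma jac_pd:
  assumes x: "x \<in> dom_of c" "x \<in> dom_of c'"
  shows "pd c' k (\<lambda>y. jac c c' y a i) x = pd c' i (\<lambda>y. jac c c' y a k) x"
    and "differentiable_in c' (\<lambda>y. jac c c' y a i) x"
proof -
  have "openin M (dom_of c)" using c1.chart by (simp add: is_chart_def)
  moreover have "smooth_on (coord c' ` (dom_of c' \<inter> dom_of c)) (\<lambda>y. coord c (point_at c' y) $ a)"
    using transition unfolding smooth_transition_def by blast
  ultimately show "pd c' k (\<lambda>y. jac c c' y a i) x = pd c' i (\<lambda>y. jac c c' y a k) x"
    "differentiable_in c' (\<lambda>y. jac c c' y a i) x"
    unfolding jac_def using pd_commute_local[OF c2.chart _ x(2,1), of "\<lambda>y. coord c y $ a"] by auto
qed

lemma frame_pd_sym: "x \<in> dom_of c \<Longrightarrow> x \<in> dom_of c' \<Longrightarrow> frame_pd x k i = frame_pd x i k"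
  unfolding frame_pd_def by (simp add: jac_pd(1)[of x k])

lemma pd_frame:
  assumes "x \<in> dom_of c" "x \<in> dom_of c'" "differentiable_in c f x"
  shows "pd c' k f x = ctr (frame x k) (\<lambda>a. pd c a f x)" and "differentiable_in c' f x"
  using pd_chain_rule[OF c1.chart c2.chart assms(1,2) transition assms(3)]
  by (simp_all add: ctr_def frame_def)

text \<open>The \<open>frame_pd\<close> term is the failure of these derivatives to be tensorial; it
  is cancelled in \<open>cov_A_frame\<close>.\<close>

lemma pd_A_frame:
  assumes x: "x \<in> dom_of c" "x \<in> dom_of c'"
  shows "pd c' i (\<lambda>y. A c' y j) x = ctr (frame_pd x i j) (A c x)
    + ctr (frame x i) (\<lambda>a. ctr (frame x j) (\<lambda>b. pd c a (\<lambda>y. A c y b) x))"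
proof -
  have o: "openin M (dom_of c)" using c1.chart by (simp add: is_chart_def)
  note d = pd_frame[OF x smooth_in_differentiable[OF c1.A_smooth x(1)]]
  have "pd c' i (\<lambda>y. A c' y j) x = pd c' i (\<lambda>y. \<Sum>a\<in>UNIV. jac c c' y a j * A c y a) x"
    by (rule pd_cong_open[OF c2.chart o x(2,1)]) (simp add: A_trans)
  also have "\<dots> = (\<Sum>a\<in>UNIV. pd c' i (\<lambda>y. jac c c' y a j) x * A c x a)
      + (\<Sum>a\<in>UNIV. jac c c' x a j * pd c' i (\<lambda>y. A c y a) x)"
    using d jac_pd(2)[OF x]
    by (simp add: pd_sum pd_mult[OF c2.chart x(2)] differentiable_in_intros sum.distrib)
  also have "\<dots> = ctr (frame_pd x i j) (A c x) + ctr (frame x j) (\<lambda>b. ctr (frame x i) (\<lambda>a. pd c a (\<lambda>y. A c y b) x))"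
    unfolding d by (simp add: ctr_def frame_pd_def frame_def)
  finally show ?thesis by (subst ctr_swap)
qed

lemma pd_g_frame:
  assumes x: "x \<in> dom_of c" "x \<in> dom_of c'"
  shows "pd c' k (\<lambda>y. g c' y i j) x = bil (g c x) (frame_pd x k i) (frame x j)
    + bil (g c x) (frame_pd x k j) (frame x i)
    + ctr (frame x k) (\<lambda>e. bil (\<lambda>a b. pd c e (\<lambda>y. g c y a b) x) (frame x i) (frame x j))"
proof -
  have o: "openin M (dom_of c)" using c1.chart by (simp add: is_chart_def)
  note d = pd_frame[OF x smooth_in_differentiable[OF c1.g_smooth x(1)]]
  have "pd c' k (\<lambda>y. g c' y i j) x
      = pd c' k (\<lambda>y. \<Sum>a\<in>UNIV. \<Sum>b\<in>UNIV. jac c c' y a i * jac c c' y b j * g c y a b) x"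
    by (rule pd_cong_open[OF c2.chart o x(2,1)]) (simp add: g_trans)
  also have "\<dots> = (\<Sum>a\<in>UNIV. \<Sum>b\<in>UNIV. pd c' k (\<lambda>y. jac c c' y a i) x * jac c c' x b j * g c x a b
      + jac c c' x a i * pd c' k (\<lambda>y. jac c c' y b j) x * g c x a b
      + jac c c' x a i * jac c c' x b j * pd c' k (\<lambda>y. g c y a b) x)"
    using d jac_pd(2)[OF x]
    by (simp add: pd_sum pd_mult[OF c2.chart x(2)] differentiable_in_intros algebra_simps)
  also have "\<dots> = bil (g c x) (frame_pd x k i) (frame x j) + bil (g c x) (frame x i) (frame_pd x k j)
     + bil (\<lambda>a b. ctr (frame x k) (\<lambda>e. pd c e (\<lambda>y. g c y a b) x)) (frame x i) (frame x j)"
    unfolding d by (simp add: bil_def ctr_def frame_pd_def frame_def sum.distrib sum_distrib_left mult_ac)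
  also have "bil (g c x) (frame x i) (frame_pd x k j) = bil (g c x) (frame_pd x k j) (frame x i)"
    by (rule bil_commute) (rule c1.g_sym[OF x(1)])
  also have "bil (\<lambda>a b. ctr (frame x k) (\<lambda>e. pd c e (\<lambda>y. g c y a b) x)) (frame x i) (frame x j)
    = ctr (frame x k) (\<lambda>e. bil (\<lambda>a b. pd c e (\<lambda>y. g c y a b) x) (frame x i) (frame x j))"
    unfolding bil_def by (simp only: ctr_swap[of "frame x k"])
  finally show ?thesis .
qed

text \<open>Of the six \<open>frame_pd\<close> terms arising from the metric derivatives, four
  cancel in pairs by \<open>frame_pd_sym\<close> and the remaining two coincide.\<close>

lemma christoffel_low_frame:
  assumes x: "x \<in> dom_of c" "x \<in> dom_of c'"
  shows "c2.christoffel_low x l i j = bil (g c x) (frame_pd x i j) (frame x l)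
    + ctr (frame x l) (\<lambda>d. bil (\<lambda>a b. c1.christoffel_low x d a b) (frame x i) (frame x j))"
proof -
  let ?e = "frame x" and ?dg = "\<lambda>e a b. pd c e (\<lambda>y. g c y a b) x"
  have 1: "ctr (?e i) (\<lambda>a. bil (?dg a) (?e j) (?e l)) = ctr (?e l) (\<lambda>d. bil (\<lambda>a b. ?dg a b d) (?e i) (?e j))"
    unfolding bil_def by (rule ctr_rotate)
  have 2: "ctr (?e j) (\<lambda>b. bil (?dg b) (?e i) (?e l)) = ctr (?e l) (\<lambda>d. bil (\<lambda>a b. ?dg b a d) (?e i) (?e j))"
  proof -
    have "(\<lambda>d. ctr (?e j) (\<lambda>b. ctr (?e i) (\<lambda>a. ?dg b a d)))
        = (\<lambda>d. ctr (?e i) (\<lambda>a. ctr (?e j) (\<lambda>b. ?dg b a d)))"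
      by (rule ext) (rule ctr_swap)
    then show ?thesis unfolding bil_def by (simp only: ctr_rotate[of "?e j"])
  qed
  have "c2.christoffel_low x l i j = bil (g c x) (frame_pd x i j) (?e l)
    + 1/2 * (ctr (?e i) (\<lambda>a. bil (?dg a) (?e j) (?e l)) + ctr (?e j) (\<lambda>b. bil (?dg b) (?e i) (?e l))
       - ctr (?e l) (\<lambda>d. bil (?dg d) (?e i) (?e j)))"
    unfolding c2.christoffel_low_def pd_g_frame[OF x] frame_pd_sym[OF x, of j i] frame_pd_sym[OF x, of l]
    by (simp add: algebra_simps)
  also have "\<dots> = bil (g c x) (frame_pd x i j) (?e l)
    + ctr (?e l) (\<lambda>d. bil (\<lambda>a b. c1.christoffel_low x d a b) (?e i) (?e j))"
    unfolding 1 2 unfolding c1.christoffel_low_def bil_def by (simp add: ctr_linear)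
  finally show ?thesis .
qed

text \<open>A vector killed by the Jacobian would lie in the radical of \<open>g c' x\<close>, which
  is the pullback of \<open>g c x\<close>; nondegeneracy thus makes the Jacobian injective.\<close>

lemma frame_independent:
  assumes x: "x \<in> dom_of c" "x \<in> dom_of c'" and v: "push x v = 0"
  shows "v = 0"
proof -
  interpret b: curvature_algebra "g c' x" "inv_metric g c' x" "A c' x" "c2.K x" "c2.cov_A x" "\<beta> x" "norm_sq g A c' x"
    by (rule c2.curvature_algebra_at[OF x(2)])
  show ?thesis
  proof (rule b.g_nondegenerate)
    fix w
    have "bil (g c' x) v w = ctr v (\<lambda>i. ctr (frame x i) (\<lambda>a. ctr w (\<lambda>j. ctr (frame x j) (g c x a))))"
      unfolding bil_def g_frame[OF x] by (simp only: ctr_swap[of w])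
    also have "\<dots> = 0" unfolding ctr_push v by (simp add: ctr_linear_left)
    finally show "bil (g c' x) v w = 0" .
  qed
qed

lemma bil_push: "bil (\<lambda>i j. bil t (frame x i) (frame x j)) v w = bil t (push x v) (push x w)"
proof -
  have "bil (\<lambda>i j. bil t (frame x i) (frame x j)) v w
      = ctr v (\<lambda>i. ctr (frame x i) (\<lambda>a. ctr w (\<lambda>j. ctr (frame x j) (t a))))"
    unfolding bil_def by (simp only: ctr_swap[of w])
  then show ?thesis unfolding ctr_push bil_def by simp
qed

lemma g_push:
  assumes "x \<in> dom_of c" "x \<in> dom_of c'"
  shows "bil (g c' x) v w = bil (g c x) (push x v) (push x w)"
proof -
  have "g c' x = (\<lambda>i j. bil (g c x) (frame x i) (frame x j))"
    by (intro ext) (rule g_frame[OF assms])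
  then show ?thesis by (simp only: bil_push)
qed

lemma A_push: "x \<in> dom_of c \<Longrightarrow> x \<in> dom_of c' \<Longrightarrow> ctr v (A c' x) = ctr (push x v) (A c x)"
  using ctr_push[of v x "A c x"] unfolding ctr_def[of v] by (simp add: A_frame)

text \<open>The metric dual of \<open>A\<close> is determined by its \<open>g\<close>-products, and
  \<open>push\<close> respects \<open>g\<close> and \<open>A\<close>. Being injective in equal
  dimensions, \<open>push\<close> reaches every test vector.\<close>

lemma frame_dual:
  assumes x: "x \<in> dom_of c" "x \<in> dom_of c'"
  shows "push x (curvature_algebra.V (inv_metric g c' x) (A c' x))
    = curvature_algebra.V (inv_metric g c x) (A c x)"
    and "norm_sq g A c' x = norm_sq g A c x"
proof -
  interpret a: curvature_algebra "g c x" "inv_metric g c x" "A c x" "c1.K x" "c1.cov_A x" "\<beta> x" "norm_sq g A c x"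
    by (rule c1.curvature_algebra_at[OF x(1)])
  interpret b: curvature_algebra "g c' x" "inv_metric g c' x" "A c' x" "c2.K x" "c2.cov_A x" "\<beta> x" "norm_sq g A c' x"
    by (rule c2.curvature_algebra_at[OF x(2)])
  have "linear (push x)"
    unfolding push_def by (intro linearI) (simp_all add: scaleR_add_left sum.distrib scaleR_sum_right)
  moreover have "inj (push x)"
    using calculation linear_injective_0 frame_independent[OF x] by blast
  ultimately have sj: "surj (push x)" using linear_injective_imp_surjective by blast
  have "push x b.V - a.V = 0"
  proof (rule a.g_nondegenerate)
    fix Y
    obtain w where w: "Y = push x w" using sj by blast
    have "bil (g c x) (push x b.V) Y = ctr w (A c' x)"
      unfolding w g_push[OF x, symmetric] bil_commute[of "g c' x" b.V, OF b.gs]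
      by (simp add: bil_def b.ctr_V_g)
    moreover have "bil (g c x) a.V Y = ctr Y (A c x)"
      unfolding bil_commute[of "g c x" a.V, OF a.gs] by (simp add: bil_def a.ctr_V_g)
    ultimately show "bil (g c x) (push x b.V - a.V) Y = 0"
      using A_push[OF x, of w] w by (simp add: bil_linear)
  qed
  then show V: "push x b.V = a.V" by simp
  show "norm_sq g A c' x = norm_sq g A c x"
    using A_push[OF x, of b.V] unfolding V a.ctr_V_A b.ctr_V_A .
qed

text \<open>Contracting the inhomogeneous term of \<open>christoffel_low_frame\<close> with
  \<open>V\<close> evaluates \<open>A\<close> on \<open>frame_pd\<close>, which is exactly the extra
  term of \<open>pd_A_frame\<close>.\<close>

lemma cov_A_frame:
  assumes x: "x \<in> dom_of c" "x \<in> dom_of c'"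
  shows "c2.cov_A x i j = bil (c1.cov_A x) (frame x i) (frame x j)"
proof -
  interpret a: curvature_algebra "g c x" "inv_metric g c x" "A c x" "c1.K x" "c1.cov_A x" "\<beta> x" "norm_sq g A c x"
    by (rule c1.curvature_algebra_at[OF x(1)])
  interpret b: curvature_algebra "g c' x" "inv_metric g c' x" "A c' x" "c2.K x" "c2.cov_A x" "\<beta> x" "norm_sq g A c' x"
    by (rule c2.curvature_algebra_at[OF x(2)])
  let ?e = "frame x"
  have "ctr b.V (\<lambda>l. bil (g c x) (frame_pd x i j) (?e l)) = ctr (frame_pd x i j) (\<lambda>a. ctr b.V (\<lambda>l. ctr (?e l) (g c x a)))"
    unfolding bil_def by (rule ctr_swap)
  also have "\<dots> = ctr (frame_pd x i j) (A c x)"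
    unfolding ctr_push frame_dual[OF x] by (simp add: a.ctr_V_g)
  finally have 1: "ctr b.V (\<lambda>l. bil (g c x) (frame_pd x i j) (?e l)) = ctr (frame_pd x i j) (A c x)" .
  have 2: "ctr b.V (\<lambda>l. ctr (?e l) (\<lambda>d. bil (\<lambda>a b. c1.christoffel_low x d a b) (?e i) (?e j)))
    = bil (\<lambda>a b. ctr a.V (\<lambda>d. c1.christoffel_low x d a b)) (?e i) (?e j)"
    unfolding ctr_push frame_dual[OF x] bil_def by (rule ctr_rotate[symmetric])
  have 3: "c1.cov_A x = (\<lambda>i j. pd c i (\<lambda>y. A c y j) x - ctr a.V (\<lambda>l. c1.christoffel_low x l i j))"
    by (intro ext) (rule c1.cov_A_contr[OF x(1)])
  show ?thesis
    unfolding c2.cov_A_contr[OF x(2)] pd_A_frame[OF x] christoffel_low_frame[OF x]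
    by (simp add: ctr_linear 1 2) (simp add: bil_def 3 ctr_linear)
qed

text \<open>At a pair with \<open>X\<close> in the hyperplane and nonzero \<open>g\<close>-product
  with \<open>U\<close>, the relation in \<open>ricci_form\<close> fixes the factor by quantities
  that agree in both charts, so \<open>l = l'\<close>.\<close>

lemma scalar_curv_eq:
  assumes x: "x \<in> dom_of c" "x \<in> dom_of c'"
  shows "scalar_curv g c x = scalar_curv g c' x"
proof -
  interpret b: curvature_algebra "g c' x" "inv_metric g c' x" "A c' x" "c2.K x" "c2.cov_A x" "\<beta> x" "norm_sq g A c' x"
    by (rule c2.curvature_algebra_at[OF x(2)])
  obtain l where l: "l \<noteq> 0"
    "\<And>U X. ctr X (A c x) = 0 \<Longrightarrow>
      l * bil (c1.cov_A x) U X = - \<beta> x / 2 * (norm_sq g A c x)^2 * bil (g c x) U X"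
    "scalar_curv g c x = 2 * (real CARD('n) - 1) * (l / norm_sq g A c x)
      - real CARD('n) * (real CARD('n) - 1) * \<psi> x"
    using c1.ricci_form[OF x(1)] by metis
  obtain l' where l': "l' \<noteq> 0"
    "\<And>U X. ctr X (A c' x) = 0 \<Longrightarrow>
      l' * bil (c2.cov_A x) U X = - \<beta> x / 2 * (norm_sq g A c' x)^2 * bil (g c' x) U X"
    "scalar_curv g c' x = 2 * (real CARD('n) - 1) * (l' / norm_sq g A c' x)
      - real CARD('n) * (real CARD('n) - 1) * \<psi> x"
    using c2.ricci_form[OF x(2)] by metis
  obtain X where X: "X \<noteq> 0" "ctr X (A c' x) = 0"
    using exists_common_kernel[OF c1.dim, of "A c' x" "A c' x" "A c' x"] by blast
  obtain U where U: "bil (g c' x) X U \<noteq> 0" using b.g_nondegenerate X(1) by blast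
  have nz: "- \<beta> x / 2 * (norm_sq g A c' x)^2 * bil (g c' x) U X \<noteq> 0"
    using U b.b b.A2_nz bil_commute[of "g c' x" U X, OF b.gs] by simp
  have "bil (c2.cov_A x) U X = bil (c1.cov_A x) (push x U) (push x X)"
    using bil_push[of "c1.cov_A x" x U X] unfolding cov_A_frame[OF x, symmetric] .
  moreover have "l * bil (c1.cov_A x) (push x U) (push x X)
     = - \<beta> x / 2 * (norm_sq g A c' x)^2 * bil (g c' x) U X"
    using l(2)[of "push x X" "push x U"] X(2)
    unfolding A_push[OF x] g_push[OF x] frame_dual(2)[OF x] by simp
  moreover have "l' * bil (c2.cov_A x) U X = - \<beta> x / 2 * (norm_sq g A c' x)^2 * bil (g c' x) U X"
    by (rule l'(2)[OF X(2)])
  ultimately have "l = l'" using nz by (metis mult_right_cancel mult_zero_right)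
  then show ?thesis unfolding l(3) l'(3) frame_dual(2)[OF x] by simp
qed

end

section \<open>The perfect fluid form\<close>

theorem mainTheorem3:
  fixes M :: "'m topology"
    and \<A> :: "('m, 'n::finite) chart set"
    and g :: "('m, 'n) tensor2"
    and A :: "('m, 'n) tensor1"
    and \<beta> \<psi> :: "'m \<Rightarrow> real"
    and T :: "('m, 'n) tensor2"
    and u :: "('m, 'n) tensor1"
    and \<kappa> n :: real
  assumes "extended_recurrent_manifold M \<A> g A \<beta> \<psi>"
    and "lorentzian \<A> g"
    and "CARD('n) > 3"
    and "n = real CARD('n)"
    and "\<forall>c\<in>\<A>. \<forall>x\<in>dom_of c. norm_sq g A c x < 0"
    and "\<forall>c\<in>\<A>. \<forall>x\<in>dom_of c. \<forall>k. u c x k = A c x k / sqrt (- norm_sq g A c x)"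
    and "\<kappa> > 0"
    and "\<forall>c\<in>\<A>. \<forall>x\<in>dom_of c. \<forall>k l.
           ricci g c x k l - 1/2 * scalar_curv g c x * g c x k l = \<kappa> * T c x k l"
  shows "\<exists>p \<mu> :: 'm \<Rightarrow> real.
      (\<forall>c\<in>\<A>. \<forall>x\<in>dom_of c.
         (\<forall>k l. T c x k l = (p x + \<mu> x) * u c x k * u c x l + p x * g c x k l) \<and>
         \<kappa> * p x = - ((n - 2) / (2 * (n - 1))) * (scalar_curv g c x + \<psi> x * (n - 1)) \<and>
         \<kappa> * \<mu> x = - (1/2) * \<psi> x * (n - 1) * (n - 2) \<and>
         p x = \<mu> x / (n - 1) - (n - 2) / (2 * (n - 1)) * (scalar_curv g c x / \<kappa>)) \<and>
      (CARD('n) = 4 \<and> (\<forall>c\<in>\<A>. \<forall>x\<in>dom_of c. scalar_curv g c x = 0) \<longrightarrow>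
         (\<forall>x\<in>topspace M. p x = \<mu> x / 3))"
proof -
  note ext = assms(1)[unfolded extended_recurrent_manifold_def]
  have rc: "recurrent_chart M c g A \<beta> \<psi>" if c: "c \<in> \<A>" for c
  proof
    have top: "x \<in> topspace M" if "x \<in> dom_of c" for x
      using ext c that unfolding smooth_manifold_def by blast
    show "is_chart M c" using ext c by (simp add: smooth_manifold_def)
    show "smooth_in c (\<lambda>x. g c x i j)" for i j
      using ext c by (simp add: pseudo_riemannian_metric_def two_tensor_def)
    show "g c x i j = g c x j i" if "x \<in> dom_of c" for x i j
      using ext c that by (simp add: pseudo_riemannian_metric_def)
    show "invertible (metric_matrix g c x)" if "x \<in> dom_of c" for x
      using ext c that by (simp add: pseudo_riemannian_metric_def)
    show "smooth_in c (\<lambda>x. A c x i)" for i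
      using ext c by (simp add: one_form_def)
    show "pd c i (\<lambda>y. A c y j) x = pd c j (\<lambda>y. A c y i) x" if "x \<in> dom_of c" for x i j
      using ext c that by (simp add: closed_form_def)
    show "smooth_in c \<psi>" using ext c by (simp add: smooth_scalar_def)
    show "pd c j \<psi> x = \<beta> x * A c x j" if "x \<in> dom_of c" for x j
      using ext c that by blast
    show "\<beta> x \<noteq> 0" if "x \<in> dom_of c" for x using ext top[OF that] by blast
    show "norm_sq g A c x \<noteq> 0" if "x \<in> dom_of c" for x using assms(5) c that by fastforce
    show "CARD('n) > 3" by (rule assms(3))
    show "cov_deriv4 g c (riemann g c) x i j k l m =
          A c x i * riemann g c x j k l m
          + (\<beta> x - \<psi> x) * A c x i * G_tensor g c x j k l m
          + \<beta> x / 2 *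
              (A c x j * G_tensor g c x i k l m + A c x k * G_tensor g c x j i l m
               + A c x l * G_tensor g c x j k i m + A c x m * G_tensor g c x j k l i)"
      if "x \<in> dom_of c" for x i j k l m
      using ext c that by blast
  qed
  have R_eq: "scalar_curv g c x = scalar_curv g c' x"
    if c: "c \<in> \<A>" "c' \<in> \<A>" and x: "x \<in> dom_of c" "x \<in> dom_of c'" for c c' x
  proof -
    have "smooth_transition c' c" using ext c by (simp add: smooth_manifold_def)
    moreover have "A c' x i = (\<Sum>a\<in>UNIV. jac c c' x a i * A c x a)"
      if "x \<in> dom_of c \<inter> dom_of c'" for x i
      using ext c that unfolding one_form_def by blast
    moreover have "g c' x i j = (\<Sum>a\<in>UNIV. \<Sum>b\<in>UNIV. jac c c' x a i * jac c c' x b j * g c x a b)"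
      if "x \<in> dom_of c \<inter> dom_of c'" for x i j
      using ext c that unfolding pseudo_riemannian_metric_def two_tensor_def by blast
    ultimately interpret overlapping_charts M c c' g A \<beta> \<psi>
      using rc[OF c(1)] rc[OF c(2)]
      by (intro overlapping_charts.intro overlapping_charts_axioms.intro)
    show ?thesis by (rule scalar_curv_eq[OF x])
  qed
  \<comment> \<open>\<open>m\<close> stands for \<open>n - 1\<close>, so that the denominators are
    visibly nonzero.\<close>
  obtain m where m: "n = m + 1" "m > 2" using assms(3,4) that[of "n - 1"] by simp
  \<comment> \<open>An arbitrary chart around \<open>x\<close> is chosen; \<open>R_eq\<close> makes
    the value independent of it.\<close>
  define R where "R x = scalar_curv g (SOME c. c \<in> \<A> \<and> x \<in> dom_of c) x" for x
  have R: "R x = scalar_curv g c x" if "c \<in> \<A>" "x \<in> dom_of c" for c x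
  proof -
    have "(SOME c. c \<in> \<A> \<and> x \<in> dom_of c) \<in> \<A> \<and> x \<in> dom_of (SOME c. c \<in> \<A> \<and> x \<in> dom_of c)"
      by (rule someI[where P = "\<lambda>c. c \<in> \<A> \<and> x \<in> dom_of c"]) (use that in simp)
    then show ?thesis unfolding R_def using R_eq that by blast
  qed
  define p where "p x = - ((n - 2) / (2 * (n - 1))) * (R x + \<psi> x * (n - 1)) / \<kappa>" for x
  define \<mu> where "\<mu> x = - (1/2) * \<psi> x * (n - 1) * (n - 2) / \<kappa>" for x
  have kp: "\<kappa> * p x = - ((n - 2) / (2 * (n - 1))) * (R x + \<psi> x * (n - 1))" for x
    using assms(7) by (simp add: p_def)
  have km: "\<kappa> * \<mu> x = - (1/2) * \<psi> x * (n - 1) * (n - 2)" for x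
    using assms(7) by (simp add: \<mu>_def)
  have state: "p x = \<mu> x / (n - 1) - (n - 2) / (2 * (n - 1)) * (R x / \<kappa>)" for x
    using m(2) assms(7) by (simp add: p_def \<mu>_def m(1) field_simps)
  have T: "T c x k l = (p x + \<mu> x) * u c x k * u c x l + p x * g c x k l"
    if c: "c \<in> \<A>" and x: "x \<in> dom_of c" for c x k l
  proof -
    interpret recurrent_chart M c g A \<beta> \<psi> by (rule rc[OF c])
    define D where "D = A c x k * A c x l / norm_sq g A c x"
    \<comment> \<open>\<open>q\<close> is the factor \<open>l\<close> of \<open>ricci_form\<close>
      divided by \<open>norm_sq g A c x\<close>.\<close>
    obtain q where Rq: "R x = 2 * (n - 1) * q - n * (n - 1) * \<psi> x"
      and ric: "ricci g c x k l = (q - (n - 1) * \<psi> x) * g c x k l + (n - 2) * q * D"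
      using ricci_form[OF x] unfolding R[OF c x] assms(4) D_def by metis
    have neg: "norm_sq g A c x < 0" using assms(5) c x by blast
    have uu: "u c x k * u c x l = - D"
    proof -
      have "u c x k * u c x l = A c x k * A c x l / (sqrt (- norm_sq g A c x))^2"
        using assms(6) c x by (simp add: power2_eq_square)
      then show ?thesis using neg by (simp add: D_def)
    qed
    \<comment> \<open>In \<open>R x + \<psi> x * (n - 1)\<close> a factor \<open>n - 1\<close>
      splits off and cancels the denominator. Then
      \<open>\<kappa> * p x + \<kappa> * \<mu> x\<close> is \<open>- (n - 2) * q\<close>, which with
      \<open>uu\<close> matches the \<open>D\<close> term of \<open>ric\<close>.\<close>
    have kp': "\<kappa> * p x = - (n - 2) / 2 * (2 * q - (n - 1) * \<psi> x)"
      using m(2) unfolding kp Rq m(1) by (simp add: field_simps)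
    have "\<kappa> * T c x k l = ricci g c x k l - 1/2 * R x * g c x k l"
      using assms(8) c x R[OF c x] by simp
    also have "\<dots> = (\<kappa> * p x + \<kappa> * \<mu> x) * (u c x k * u c x l) + \<kappa> * p x * g c x k l"
      unfolding ric Rq uu kp' km by (simp add: field_simps)
    finally have "\<kappa> * T c x k l = \<kappa> * ((p x + \<mu> x) * u c x k * u c x l + p x * g c x k l)"
      by (simp add: algebra_simps)
    then show ?thesis using assms(7) by simp
  qed
  have main: "(\<forall>k l. T c x k l = (p x + \<mu> x) * u c x k * u c x l + p x * g c x k l) \<and>
         \<kappa> * p x = - ((n - 2) / (2 * (n - 1))) * (scalar_curv g c x + \<psi> x * (n - 1)) \<and>
         \<kappa> * \<mu> x = - (1/2) * \<psi> x * (n - 1) * (n - 2) \<and>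
         p x = \<mu> x / (n - 1) - (n - 2) / (2 * (n - 1)) * (scalar_curv g c x / \<kappa>)"
    if c: "c \<in> \<A>" and x: "x \<in> dom_of c" for c x
    using T[OF c x] state[of x] kp[of x] km[of x] unfolding R[OF c x, symmetric] by blast
  have "p x = \<mu> x / 3"
    if "CARD('n) = 4" "\<forall>c\<in>\<A>. \<forall>x\<in>dom_of c. scalar_curv g c x = 0" "x \<in> topspace M" for x
  proof -
    obtain c where "c \<in> \<A>" "x \<in> dom_of c"
      using ext \<open>x \<in> topspace M\<close> unfolding smooth_manifold_def by blast
    then have "R x = 0" using R that(2) by simp
    then show ?thesis using state[of x] that(1) assms(4) by simp
  qed
  with main show ?thesis by blast
qed

end
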